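(* For any graph $H$ and any $k\ge|V(H)|$, the polynomial $p_n^{(k,[H])}(X)=\mathbb E\big[m_k^{[H]}(L_{k,n}X)\big]$, $X\in\mathbb S^n$, is given by $$p_n^{(k,[H])}(X)=\sum_{[G]\le_R[H]}\frac{H!}{G!}\cdot\frac{(k)_{|V(H)|}}{k^{|V(G)|}}\cdot\frac{R_{[G],[H]}}{R_{[H],[H]}}\,m_n^{[G]}(X),$$ where $H!=\prod_{i\le j}H_{i,j}!$ and $(k)_\ell=\frac{k!}{(k-\ell)!}$. As $[H]$ ranges over isomorphism classes of graphs with at most $d$ edges, each of the collections $\{(p_n^{(k,[H])})_n\}_{|H|\le d}$ where $k\ge2d$, $\{(m_n^{[H]})_n\}_{|H|\le d}$, $\{(\mathrm{inj}(H;\cdot)|_{\mathbb S^n})_n\}_{|H|\le d}$, and $\{(\mathrm{hom}(H;\cdot)|_{\mathbb S^n})_n\}_{|H|\le d}$ forms a basis for the freely-described polynomials of degree at most $d$ over $\mathrm{Sym}^2\mathcal Z$.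
   Context: Here $n,k$ are positive integers, $[n]=\{1,\dots,n\}$, and $\mathbb S^n$ is the space of real symmetric $n\times n$ matrices, on which $\mathfrak S_n$ acts by simultaneously permuting rows and columns. Let $E_{i,i}=e_ie_i^\top$ and $E_{i,j}=e_ie_j^\top+e_je_i^\top$ for $i\ne j$. A graph (multiple edges and self-loops allowed) is a symmetric matrix $H\in\mathbb S^k(\mathbb N)$ with nonnegative integer entries, $H_{i,j}$ being the number of edges $\{i,j\}$. Vertex $i$ is isolated if its row in $H$ is zero. $[H]$ is the isomorphism class of $H$ with all isolated vertices removed, $|V(H)|$ is the number of non-isolated vertices, and $|H|=\sum_{i\le j}H_{i,j}$ is the number of edges. For $n\ge|V(H)|$, view $H\in\mathbb S^n(\mathbb N)$ (after removing isolated vertices) by zero-padding and set $X^G=\prod_{i\le j}X_{i,j}^{G_{i,j}}$ and $m_n^{[H]}(X)=\sum_{G\in\mathfrak S_nH}X^G$, the sum over the distinct elements of the orbit; set $m_n^{[H]}=0$ if $n<|V(H)|$. Taking $H$ without isolated vertices, with $v=|V(H)|$: $\mathrm{hom}(H;X)=\sum_{f:[v]\to[n]}\prod_{i\le j,\,H_{i,j}\ne0}X_{f(i),f(j)}^{H_{i,j}}$ for $X\in\mathbb S^n$, and $\mathrm{inj}(H;X)$ is the same sum restricted to injective $f$. For the class of edgeless graphs, these are the constant polynomial $1$. For $X\in\mathbb S^n$ and $f:[n]\to[k]$ with induced ordered partition $P_f=(f^{-1}(1),\dots,f^{-1}(k))$, let $X/P_f=\sum_{i\le j}X_{i,j}E_{f(i),f(j)}\in\mathbb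 S^k$. The random linear map $L_{k,n}:\mathbb S^n\to\mathbb S^k$ is $L_{k,n}X=X/P_{F_{k,n}}$ with $F_{k,n}:[n]\to[k]$ a uniformly random map. Write $G\le_RH$, also $[G]\le_R[H]$ ($G$ is a refinement of $H$), if there is a surjection $f:V(G)\to V(H)$ with $G/P_f=H$; for representatives $G,H$ without isolated vertices, $R_{[G],[H]}$ is the number of such surjections. A freely-described polynomial of degree at most $d$ over $\mathrm{Sym}^2\mathcal Z$ is a sequence $(p_n)_{n\ge1}$ of $\mathfrak S_n$-invariant polynomials $p_n$ on $\mathbb S^n$ of degree at most $d$ such that for all $n\le N$ and $X\in\mathbb S^n$, $p_N(X\oplus0_{N-n})=p_n(X)$, where $X\oplus0_{N-n}$ is $X$ zero-padded to an $N\times N$ matrix. These form a vector space under termwise operations. *)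

theory Defs
  imports
    "HOL-Probability.Probability"
    "HOL-Library.Function_Algebras"
    "HOL-Combinatorics.Permutations"
    "Jordan_Normal_Form.DL_Submatrix"
begin

text \<open>
  Matrix indices are zero-based, so the set \<open>[n] = {1, ..., n}\<close> of the mathematics is
  \<open>{..<n}\<close> here, and maps \<open>[n] \<rightarrow> [k]\<close> are the elements of \<open>{..<n} \<rightarrow>\<^sub>E {..<k}\<close>.
\<close>

subsection \<open>Symmetric matrices and graphs\<close>

definition sym_mats :: "nat \<Rightarrow> 'a mat set" where
  "sym_mats n = {A \<in> carrier_mat n n. transpose_mat A = A}"

definition upper_pairs :: "nat \<Rightarrow> (nat \<times> nat) set" where
  "upper_pairs n = {(i, j). i \<le> j \<and> j < n}"

definition permute_mat :: "(nat \<Rightarrow> nat) \<Rightarrow> 'a mat \<Rightarrow> 'a mat" where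
  "permute_mat \<sigma> A = Matrix.mat (dim_row A) (dim_col A) (\<lambda>(i, j). A $$ (\<sigma> i, \<sigma> j))"

definition perm_orbit :: "nat \<Rightarrow> 'a mat \<Rightarrow> 'a mat set" where
  "perm_orbit n A = {permute_mat \<sigma> A | \<sigma>. \<sigma> permutes {..<n}}"

text \<open>The zero-padding \<open>A \<oplus> 0\<close> of size \<open>N\<close>, for a square matrix \<open>A\<close> of size at most \<open>N\<close>.\<close>

definition zero_pad :: "nat \<Rightarrow> 'a::zero mat \<Rightarrow> 'a mat" where
  "zero_pad N A = diag_block_mat [A, 0\<^sub>m (N - dim_row A) (N - dim_row A)]"

text \<open>The \<open>0 \<times> 0\<close> matrix is admitted: it is the edgeless graph without its isolated vertices.\<close>

definition is_graph :: "nat mat \<Rightarrow> bool" where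
  "is_graph H \<longleftrightarrow> H \<in> sym_mats (dim_row H)"

definition verts :: "nat mat \<Rightarrow> nat set" where
  "verts H = {i. i < dim_row H \<and> (\<exists>j < dim_col H. H $$ (i, j) \<noteq> 0)}"

definition num_edges :: "nat mat \<Rightarrow> nat" where
  "num_edges H = (\<Sum>(i, j) \<in> upper_pairs (dim_row H). H $$ (i, j))"

definition graph_fact :: "nat mat \<Rightarrow> nat" where
  "graph_fact H = (\<Prod>(i, j) \<in> upper_pairs (dim_row H). fact (H $$ (i, j)))"

definition remove_isolated :: "nat mat \<Rightarrow> nat mat" where
  "remove_isolated H = submatrix H (verts H) (verts H)"

definition iso_class :: "nat mat \<Rightarrow> nat mat set" where
  "iso_class H = perm_orbit (card (verts H)) (remove_isolated H)"

definition iso_classes :: "nat mat set set" where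
  "iso_classes = {iso_class H | H. is_graph H}"

definition iso_classes_upto :: "nat \<Rightarrow> nat mat set set" where
  "iso_classes_upto d = {iso_class H | H. is_graph H \<and> num_edges H \<le> d}"

text \<open>
  A representative without isolated vertices. It is only plugged into quantities attached to an
  isomorphism class (\<open>m\<^sub>n\<close>, \<open>hom\<close>, \<open>inj\<close>, the numbers of vertices, edges and refinement maps,
  ...), so the choice does not matter.
\<close>

definition rep :: "nat mat set \<Rightarrow> nat mat" where
  "rep C = (SOME G. G \<in> C)"


subsection \<open>Monomials, homomorphism polynomials\<close>

definition mat_monomial :: "nat mat \<Rightarrow> real mat \<Rightarrow> real" where
  "mat_monomial G X = (\<Prod>(i, j) \<in> upper_pairs (dim_row G). X $$ (i, j) ^ (G $$ (i, j)))"

definition sym_monomial :: "nat mat \<Rightarrow> nat \<Rightarrow> real mat \<Rightarrow> real" where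
  "sym_monomial H n X =
     (if card (verts H) \<le> n
      then \<Sum>G \<in> perm_orbit n (zero_pad n (remove_isolated H)). mat_monomial G X
      else 0)"

definition map_weight :: "nat mat \<Rightarrow> real mat \<Rightarrow> (nat \<Rightarrow> nat) \<Rightarrow> real" where
  "map_weight H X f =
     (\<Prod>(i, j) \<in> {(i, j) \<in> upper_pairs (dim_row H). H $$ (i, j) \<noteq> 0}.
        X $$ (f i, f j) ^ (H $$ (i, j)))"

definition hom_poly :: "nat mat \<Rightarrow> real mat \<Rightarrow> real" where
  "hom_poly H X =
     (\<Sum>f \<in> {..<card (verts H)} \<rightarrow>\<^sub>E {..<dim_row X}. map_weight (remove_isolated H) X f)"

definition inj_poly :: "nat mat \<Rightarrow> real mat \<Rightarrow> real" where
  "inj_poly H X =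
     (\<Sum>f \<in> {f \<in> {..<card (verts H)} \<rightarrow>\<^sub>E {..<dim_row X}. inj_on f {..<card (verts H)}}.
        map_weight (remove_isolated H) X f)"


subsection \<open>Quotients by ordered partitions and refinements\<close>

text \<open>
  \<open>elem_sym k i j\<close> is \<open>e\<^sub>i e\<^sub>i\<^sup>T\<close> if \<open>i = j\<close> and \<open>e\<^sub>i e\<^sub>j\<^sup>T + e\<^sub>j e\<^sub>i\<^sup>T\<close> otherwise;
  in particular its diagonal entry is 1 (not 2) if \<open>i = j\<close>.
\<close>

definition elem_sym :: "nat \<Rightarrow> nat \<Rightarrow> nat \<Rightarrow> 'a::zero_neq_one mat" where
  "elem_sym k i j = Matrix.mat k k (\<lambda>(a, b). if {a, b} = {i, j} then 1 else 0)"

text \<open>\<open>X / P\<^sub>f\<close>, with the sum of matrices written entrywise.\<close>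

definition quotient_mat :: "nat \<Rightarrow> (nat \<Rightarrow> nat) \<Rightarrow> 'a::comm_semiring_1 mat \<Rightarrow> 'a mat" where
  "quotient_mat k f X = Matrix.mat k k (\<lambda>(a, b).
     \<Sum>(i, j) \<in> upper_pairs (dim_row X). X $$ (i, j) * elem_sym k (f i) (f j) $$ (a, b))"

definition refinement_maps :: "nat mat \<Rightarrow> nat mat \<Rightarrow> (nat \<Rightarrow> nat) set" where
  "refinement_maps G H =
     {f \<in> {..<card (verts G)} \<rightarrow>\<^sub>E {..<card (verts H)}.
        f ` {..<card (verts G)} = {..<card (verts H)} \<and>
        quotient_mat (card (verts H)) f (remove_isolated G) = remove_isolated H}"

definition is_refinement :: "nat mat \<Rightarrow> nat mat \<Rightarrow> bool" where
  "is_refinement G H \<longleftrightarrow> refinement_maps G H \<noteq> {}"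

definition num_refinements :: "nat mat \<Rightarrow> nat mat \<Rightarrow> nat" where
  "num_refinements G H = card (refinement_maps G H)"

definition random_quotient :: "nat \<Rightarrow> nat \<Rightarrow> (real mat \<Rightarrow> real mat) pmf" where
  "random_quotient k n = map_pmf (quotient_mat k) (pmf_of_set ({..<n} \<rightarrow>\<^sub>E {..<k}))"

definition expected_poly :: "nat \<Rightarrow> nat mat \<Rightarrow> nat \<Rightarrow> real mat \<Rightarrow> real" where
  "expected_poly k H n X =
     measure_pmf.expectation (random_quotient k n) (\<lambda>L. sym_monomial H k (L X))"


subsection \<open>Freely-described polynomials\<close>

text \<open>
  A sequence of functions on the spaces of symmetric \<open>n \<times> n\<close> matrices, \<open>n \<ge> 1\<close>, is encoded as a
  total function that vanishes outside these spaces, so that equality of sequences is equality in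
  HOL and the termwise operations are the pointwise ones.
\<close>

type_synonym mat_fun_seq = "nat \<Rightarrow> real mat \<Rightarrow> real"

definition restrict_seq :: "mat_fun_seq \<Rightarrow> mat_fun_seq" where
  "restrict_seq p = (\<lambda>n X. if 1 \<le> n \<and> X \<in> sym_mats n then p n X else 0)"

definition scale_seq :: "real \<Rightarrow> mat_fun_seq \<Rightarrow> mat_fun_seq" where
  "scale_seq c p = (\<lambda>n X. c * p n X)"

interpretation seqs: vector_space scale_seq
  by unfold_locales (auto simp: scale_seq_def fun_eq_iff algebra_simps)

definition polynomial_deg_le :: "nat \<Rightarrow> nat \<Rightarrow> (real mat \<Rightarrow> real) \<Rightarrow> bool" where
  "polynomial_deg_le n d q \<longleftrightarrow>
     (\<exists>c :: nat mat \<Rightarrow> real. \<forall>X \<in> sym_mats n.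
        q X = (\<Sum>G \<in> {G \<in> sym_mats n. num_edges G \<le> d}. c G * mat_monomial G X))"

definition freely_described :: "nat \<Rightarrow> mat_fun_seq set" where
  "freely_described d = {p. restrict_seq p = p \<and>
     (\<forall>n \<ge> 1. polynomial_deg_le n d (p n)) \<and>
     (\<forall>n \<ge> 1. \<forall>\<sigma>. \<sigma> permutes {..<n} \<longrightarrow> (\<forall>X \<in> sym_mats n. p n (permute_mat \<sigma> X) = p n X)) \<and>
     (\<forall>n \<ge> 1. \<forall>N \<ge> n. \<forall>X \<in> sym_mats n. p N (zero_pad N X) = p n X)}"

definition is_basis :: "'i set \<Rightarrow> ('i \<Rightarrow> mat_fun_seq) \<Rightarrow> mat_fun_seq set \<Rightarrow> bool" where
  "is_basis I b V \<longleftrightarrow> inj_on b I \<and> seqs.independent (b ` I) \<and> seqs.span (b ` I) = V"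

end

theory Submission
  imports Defs
begin

text \<open>
  A graph is encoded by the multiset of its edges, an edge between \<open>i\<close> and \<open>j\<close> being the set
  \<open>{i, j}\<close>. Padding and isolated vertices then disappear, taking the quotient by \<open>f\<close> becomes the
  image of the multiset under \<open>e \<mapsto> f ` e\<close>, and two graphs are isomorphic iff one multiset is the
  image of the other under a map that is injective on the vertices.

  Any combination of monomials whose coefficients depend only on the isomorphism class of the
  exponent is a combination of the \<open>m\<^sub>n\<close>. For \<open>hom\<close> the coefficients count maps with a given
  quotient; for \<open>\<E>[m\<^sub>k(L X)]\<close> they come from the multinomial expansion of a monomial in \<open>X / P\<^sub>f\<close>,
  followed by counting the \<open>f\<close> that send a given graph to the orbit of \<open>H\<close>.

  Monomials are linearly independent, so an invariant polynomial has coefficients that are constant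
  on isomorphism classes, and compatibility with zero-padding makes them independent of \<open>n\<close>; since
  \<open>d\<close> edges touch at most \<open>2 d\<close> vertices, every class is visible at \<open>n = 2 d\<close>. Hence the \<open>m\<^sub>n\<close>
  form a basis. The other families are triangular over it with respect to the number of vertices,
  because a refinement with as many vertices as the graph it refines is an isomorphism.
\<close>

section \<open>The multiset of edges of a graph\<close>

text \<open>Each factor of the expectation formula has its own origin. Let M be an exponent on
  \<open>{..<n}\<close> of class [G], and v = |V(H)|. The ratio H!/G! is the multinomial coefficient
  of M in a monomial of X / P_f. The number R_{[H],[H]} counts the automorphisms of H, so (k)_v /
  R_{[H],[H]} is the size of the orbit of H on k points. Each member of that orbit is the image of M
  under R_{[G],[H]} maps defined on the vertices of M; the other n - |V(G)| points may go anywhere,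
  which leaves 1 / k^|V(G)| after division by k^n. The direction of the triangularity differs
  between the families: hom expands over quotients of H, which have at most as many vertices, the
  expectation over refinements, which have at least as many, and inj is a scalar multiple of m_n.
  The bound k >= 2 d makes the expectation formula available for every class with at most d edges at
  once.\<close>

definition edge :: "'a mat \<Rightarrow> nat set \<Rightarrow> 'a" where
  "edge A e = A $$ (Min e, Max e)"

text \<open>Loops appear as singletons, so this set has exactly one member for each independent
  coordinate of a symmetric matrix.\<close>

definition edges_on :: "nat \<Rightarrow> nat set set" where
  "edges_on n = (\<lambda>(i, j). {i, j}) ` upper_pairs n"

lemma edges_on_iff: "e \<in> edges_on n \<longleftrightarrow> (\<exists>i j. i < n \<and> j < n \<and> e = {i, j})"
proof
  assume "e \<in> edges_on n"
  then obtain i j where "(i, j) \<in> upper_pairs n" "e = {i, j}"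
    by (auto simp: edges_on_def)
  then show "\<exists>i j. i < n \<and> j < n \<and> e = {i, j}"
    by (intro exI[of _ i] exI[of _ j]) (auto simp: upper_pairs_def)
next
  assume "\<exists>i j. i < n \<and> j < n \<and> e = {i, j}"
  then obtain i j where *: "i < n" "j < n" "e = {i, j}" by blast
  have "(i, j) \<in> upper_pairs n \<or> (j, i) \<in> upper_pairs n"
    using * by (auto simp: upper_pairs_def)
  then show "e \<in> edges_on n"
    unfolding edges_on_def using * by (force simp: insert_commute)
qed

lemma edges_onI [intro]: "i < n \<Longrightarrow> j < n \<Longrightarrow> {i, j} \<in> edges_on n"
  by (auto simp: edges_on_iff)

lemma edges_on_subset: "edges_on n \<subseteq> Pow {..<n}"
  by (auto simp: edges_on_iff)

lemma finite_upper_pairs [simp]: "finite (upper_pairs n)"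
  by (rule finite_subset[of _ "{..<n} \<times> {..<n}"]) (auto simp: upper_pairs_def)

lemma finite_edges_on [simp]: "finite (edges_on n)"
  by (simp add: edges_on_def)

lemma edges_on_mono: "m \<le> n \<Longrightarrow> edges_on m \<subseteq> edges_on n"
  by (force simp: edges_on_iff)

lemma image_edges_on: "f ` {..<n} \<subseteq> {..<k} \<Longrightarrow> e \<in> edges_on n \<Longrightarrow> f ` e \<in> edges_on k"
  by (force simp: edges_on_iff)

lemma inj_on_image_edges: "inj_on f {..<n} \<Longrightarrow> inj_on (image f) (edges_on n)"
  by (meson inj_on_image_Pow inj_on_subset edges_on_subset)

lemma inj_on_upper_pairs: "inj_on (\<lambda>(i, j). {i, j}) (upper_pairs n)"
  by (auto simp: inj_on_def upper_pairs_def doubleton_eq_iff)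

text \<open>Bridge from the sums over index pairs in the given definitions to sums over edges. The
  summand may depend on the set only, which is why matrix entries are rewritten with
  \<open>edge\<close> before it is applied.\<close>

lemma sum_upper_pairs: "(\<Sum>(i, j)\<in>upper_pairs n. g {i, j}) = sum g (edges_on n)"
  unfolding edges_on_def by (subst sum.reindex[OF inj_on_upper_pairs]) (simp add: case_prod_beta o_def)

lemma prod_upper_pairs: "(\<Prod>(i, j)\<in>upper_pairs n. g {i, j}) = prod g (edges_on n)"
  unfolding edges_on_def by (subst prod.reindex[OF inj_on_upper_pairs]) (simp add: case_prod_beta o_def)

lemma sym_mats_dim: "A \<in> sym_mats n \<Longrightarrow> dim_row A = n" "A \<in> sym_mats n \<Longrightarrow> dim_col A = n"
  by (auto simp: sym_mats_def)

lemma sym_mats_sym: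
  assumes "A \<in> sym_mats n" "i < n" "j < n"
  shows "A $$ (i, j) = A $$ (j, i)"
proof -
  have "transpose_mat A $$ (i, j) = A $$ (j, i)"
    using assms by (simp add: sym_mats_dim)
  moreover have "transpose_mat A = A" using assms by (simp add: sym_mats_def)
  ultimately show ?thesis by simp
qed

lemma sym_matsI:
  assumes "\<And>i j. i < n \<Longrightarrow> j < n \<Longrightarrow> g (i, j) = g (j, i)"
  shows "Matrix.mat n n g \<in> sym_mats n"
  using assms by (auto simp: sym_mats_def intro!: eq_matI)

lemma edge_doubleton:
  assumes "A \<in> sym_mats n" "i < n" "j < n"
  shows "edge A {i, j} = A $$ (i, j)"
  using sym_mats_sym[OF assms] by (cases "i \<le> j") (auto simp: edge_def max_def min_def)

lemma edge_upper: "(i, j) \<in> upper_pairs n \<Longrightarrow> edge A {i, j} = A $$ (i, j)"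
  by (auto simp: edge_def upper_pairs_def max_def min_def)

lemma sym_mats_eqI:
  assumes "A \<in> sym_mats n" "B \<in> sym_mats n" "\<And>e. e \<in> edges_on n \<Longrightarrow> edge A e = edge B e"
  shows "A = B"
proof (rule eq_matI)
  fix i j assume "i < dim_row B" "j < dim_col B"
  then have "i < n" "j < n" using assms by (auto simp: sym_mats_def)
  then show "A $$ (i, j) = B $$ (i, j)"
    using assms by (metis edge_doubleton edges_onI)
qed (use assms in \<open>auto simp: sym_mats_def\<close>)

definition edge_mset :: "nat mat \<Rightarrow> nat set multiset" where
  "edge_mset H = (\<Sum>e\<in>edges_on (dim_row H). replicate_mset (edge H e) e)"

lemma count_edge_mset:
  "count (edge_mset H) e = (if e \<in> edges_on (dim_row H) then edge H e else 0)"
  by (simp add: edge_mset_def count_sum)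

lemma set_edge_mset: "set_mset (edge_mset H) \<subseteq> edges_on (dim_row H)"
proof
  fix e assume "e \<in># edge_mset H"
  then have "count (edge_mset H) e \<noteq> 0" by simp
  then show "e \<in> edges_on (dim_row H)" by (metis count_edge_mset)
qed

text \<open>The common size matters: a graph and its zero-padding have the same edge multiset. At a
  fixed size, identities of multisets can be turned back into identities of matrices.\<close>

lemma edge_mset_inj:
  assumes "A \<in> sym_mats n" "B \<in> sym_mats n" "edge_mset A = edge_mset B"
  shows "A = B"
  using assms(1,2)
proof (rule sym_mats_eqI)
  fix e assume "e \<in> edges_on n"
  then show "edge A e = edge B e"
    using arg_cong[OF assms(3), of "\<lambda>M. count M e"] assms(1,2) by (simp add: count_edge_mset sym_mats_dim)
qed

text \<open>The inverse of \<open>edge_mset\<close> on multisets supported in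
  \<open>edges_on n\<close>; edges reaching beyond \<open>n\<close> would be lost.\<close>

definition graph_of :: "nat \<Rightarrow> nat set multiset \<Rightarrow> nat mat" where
  "graph_of n B = Matrix.mat n n (\<lambda>(i, j). count B {i, j})"

lemma graph_of_sym: "graph_of n B \<in> sym_mats n"
  unfolding graph_of_def by (rule sym_matsI) (simp add: insert_commute)

lemma edge_mset_graph_of:
  assumes "set_mset B \<subseteq> edges_on n"
  shows "edge_mset (graph_of n B) = B"
proof (rule multiset_eqI)
  fix e
  show "count (edge_mset (graph_of n B)) e = count B e"
  proof (cases "e \<in> edges_on n")
    case True
    then obtain i j where "i < n" "j < n" "e = {i, j}" by (auto simp: edges_on_iff)
    then show ?thesis
      using True edge_doubleton[OF graph_of_sym[of n B], of i j]
      by (simp add: count_edge_mset graph_of_def)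
  next
    case False
    then have "e \<notin># B" using assms by auto
    with False show ?thesis by (simp add: count_edge_mset graph_of_def not_in_iff)
  qed
qed

lemma num_edges_eq: "num_edges H = size (edge_mset H)"
proof -
  have "num_edges H = (\<Sum>(i, j)\<in>upper_pairs (dim_row H). edge H {i, j})"
    unfolding num_edges_def by (rule sum.cong) (auto simp: edge_upper)
  also have "\<dots> = sum (edge H) (edges_on (dim_row H))" by (rule sum_upper_pairs)
  also have "\<dots> = sum (count (edge_mset H)) (edges_on (dim_row H))"
    by (rule sum.cong) (auto simp: count_edge_mset)
  also have "\<dots> = size (edge_mset H)"
    unfolding size_multiset_overloaded_eq
    by (rule sum.mono_neutral_right) (use set_edge_mset[of H] in \<open>auto simp: not_in_iff\<close>)
  finally show ?thesis .
qed

definition mset_fact :: "'a multiset \<Rightarrow> nat" where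
  "mset_fact A = (\<Prod>x\<in>set_mset A. fact (count A x))"

lemma mset_fact_superset:
  "finite S \<Longrightarrow> set_mset A \<subseteq> S \<Longrightarrow> mset_fact A = (\<Prod>x\<in>S. fact (count A x))"
  unfolding mset_fact_def by (rule prod.mono_neutral_left) (auto simp: not_in_iff)

lemma mset_fact_nonzero [simp]: "mset_fact A \<noteq> 0"
  by (simp add: mset_fact_def)

lemma graph_fact_eq: "graph_fact H = mset_fact (edge_mset H)"
proof -
  have "graph_fact H = (\<Prod>(i, j)\<in>upper_pairs (dim_row H). fact (edge H {i, j}))"
    unfolding graph_fact_def by (rule prod.cong) (auto simp: edge_upper)
  also have "\<dots> = (\<Prod>e\<in>edges_on (dim_row H). fact (edge H e))" by (rule prod_upper_pairs)
  also have "\<dots> = (\<Prod>e\<in>edges_on (dim_row H). fact (count (edge_mset H) e))"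
    by (rule prod.cong) (auto simp: count_edge_mset)
  also have "\<dots> = mset_fact (edge_mset H)"
    by (rule mset_fact_superset[symmetric]) (auto simp: set_edge_mset)
  finally show ?thesis .
qed

lemma prod_mset_superset:
  fixes g :: "'a \<Rightarrow> 'b::comm_monoid_mult"
  assumes "finite S" "set_mset A \<subseteq> S"
  shows "(\<Prod>x\<in>#A. g x) = (\<Prod>x\<in>S. g x ^ count A x)"
  unfolding image_prod_mset_multiplicity using assms
  by (intro prod.mono_neutral_left) (auto simp: not_in_iff)

lemma mat_monomial_eq: "mat_monomial G X = (\<Prod>e\<in>#edge_mset G. edge X e)"
proof -
  have "mat_monomial G X = (\<Prod>(i, j)\<in>upper_pairs (dim_row G). edge X {i, j} ^ edge G {i, j})"
    unfolding mat_monomial_def by (rule prod.cong) (auto simp: edge_upper)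
  also have "\<dots> = (\<Prod>e\<in>edges_on (dim_row G). edge X e ^ edge G e)"
    by (rule prod_upper_pairs)
  also have "\<dots> = (\<Prod>e\<in>edges_on (dim_row G). edge X e ^ count (edge_mset G) e)"
    by (rule prod.cong) (auto simp: count_edge_mset)
  also have "\<dots> = (\<Prod>e\<in>#edge_mset G. edge X e)"
    by (rule prod_mset_superset[symmetric]) (auto simp: set_edge_mset)
  finally show ?thesis .
qed

lemma map_weight_eq:
  assumes "X \<in> sym_mats n" "f ` {..<dim_row H} \<subseteq> {..<n}"
  shows "map_weight H X f = (\<Prod>e\<in>#edge_mset H. edge X (f ` e))"
proof -
  \<comment> \<open>Pairs with exponent zero contribute the factor 1, so the restriction to edges
    that occur can be lifted.\<close>
  have "map_weight H X f = (\<Prod>(i, j)\<in>upper_pairs (dim_row H). X $$ (f i, f j) ^ (H $$ (i, j)))"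
    unfolding map_weight_def by (rule prod.mono_neutral_left) (auto intro!: gr0I)
  also have "\<dots> = (\<Prod>(i, j)\<in>upper_pairs (dim_row H). edge X (f ` {i, j}) ^ edge H {i, j})"
  proof (rule prod.cong)
    fix p assume p: "p \<in> upper_pairs (dim_row H)"
    obtain i j where [simp]: "p = (i, j)" by force
    have "i < dim_row H" "j < dim_row H" using p by (auto simp: upper_pairs_def)
    then have "f i < n" "f j < n" using assms(2) by auto
    then have "edge X {f i, f j} = X $$ (f i, f j)" by (rule edge_doubleton[OF assms(1)])
    then show "(case p of (i, j) \<Rightarrow> X $$ (f i, f j) ^ (H $$ (i, j))) =
      (case p of (i, j) \<Rightarrow> edge X (f ` {i, j}) ^ edge H {i, j})"
      using p by (simp add: edge_upper)
  qed simp
  also have "\<dots> = (\<Prod>e\<in>edges_on (dim_row H). edge X (f ` e) ^ edge H e)"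
    by (rule prod_upper_pairs)
  also have "\<dots> = (\<Prod>e\<in>edges_on (dim_row H). edge X (f ` e) ^ count (edge_mset H) e)"
    by (rule prod.cong) (auto simp: count_edge_mset)
  also have "\<dots> = (\<Prod>e\<in>#edge_mset H. edge X (f ` e))"
    by (rule prod_mset_superset[symmetric]) (auto simp: set_edge_mset)
  finally show ?thesis .
qed

section \<open>Vertices, and the effect of matrix operations on the edge multiset\<close>

abbreviation supp :: "nat set multiset \<Rightarrow> nat set" where
  "supp A \<equiv> \<Union>(set_mset A)"

lemma supp_edge_mset_subset: "supp (edge_mset H) \<subseteq> {..<dim_row H}"
  using set_edge_mset[of H] edges_on_subset[of "dim_row H"] by blast

lemma finite_supp_edge_mset [simp]: "finite (supp (edge_mset H))"
  by (rule finite_subset[OF supp_edge_mset_subset]) simp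

lemma verts_eq:
  assumes "H \<in> sym_mats n"
  shows "verts H = supp (edge_mset H)"
proof (intro equalityI subsetI)
  fix i assume "i \<in> verts H"
  then obtain j where ij: "i < n" "j < n" "H $$ (i, j) \<noteq> 0"
    using assms by (auto simp: verts_def sym_mats_dim)
  then have "count (edge_mset H) {i, j} \<noteq> 0"
    using assms by (auto simp: count_edge_mset edge_doubleton sym_mats_dim)
  then have "{i, j} \<in># edge_mset H" by (metis not_in_iff)
  then show "i \<in> supp (edge_mset H)" by blast
next
  fix i assume "i \<in> supp (edge_mset H)"
  then obtain e where e: "e \<in># edge_mset H" "i \<in> e" by blast
  then have "e \<in> edges_on n" using set_edge_mset[of H] assms sym_mats_dim by blast
  then obtain j where j: "e = {i, j}" "i < n" "j < n" using e(2) by (auto simp: edges_on_iff)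
  have "count (edge_mset H) e \<noteq> 0" using e by auto
  then have "H $$ (i, j) \<noteq> 0"
    using j assms by (auto simp: count_edge_mset edge_doubleton sym_mats_dim split: if_splits)
  then show "i \<in> verts H" using j assms by (auto simp: verts_def sym_mats_dim)
qed

text \<open>Each fibre of \<open>g\<close> in \<open>S\<close> is a single point, so a count in the
  image equals the count of one preimage; outside the image of \<open>S\<close> both counts are
  zero.\<close>

lemma image_mset_eqI:
  assumes "inj_on g S" "set_mset A \<subseteq> S" "set_mset B \<subseteq> g ` S"
    "\<And>x. x \<in> S \<Longrightarrow> count A x = count B (g x)"
  shows "image_mset g A = B"
proof (rule multiset_eqI)
  fix y
  show "count (image_mset g A) y = count B y"
  proof (cases "y \<in> g ` S")
    case True
    then obtain x where x: "x \<in> S" "y = g x" by blast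
    have "count (image_mset g A) y = sum (count A) (g -` {y} \<inter> set_mset A)"
      by (simp add: count_image_mset)
    also have "g -` {y} \<inter> set_mset A = {x} \<inter> set_mset A"
      using x assms(1,2) by (auto simp: inj_on_def)
    also have "sum (count A) ({x} \<inter> set_mset A) = count A x"
      by (cases "x \<in># A") (auto simp: not_in_iff)
    finally show ?thesis using assms(4) x by simp
  next
    case False
    then have "y \<notin># B" "y \<notin># image_mset g A" using assms(2,3) by auto
    then show ?thesis by (simp add: not_in_iff del: set_image_mset)
  qed
qed

lemma edge_permute_mat:
  assumes "A \<in> sym_mats n" "\<sigma> permutes {..<n}"
  shows "permute_mat \<sigma> A \<in> sym_mats n"
    and "e \<in> edges_on n \<Longrightarrow> edge (permute_mat \<sigma> A) e = edge A (\<sigma> ` e)"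
proof -
  have lt: "i < n \<Longrightarrow> \<sigma> i < n" for i using permutes_in_image[OF assms(2), of i] by simp
  have eq: "permute_mat \<sigma> A = Matrix.mat n n (\<lambda>(i, j). A $$ (\<sigma> i, \<sigma> j))"
    using assms(1) by (simp add: permute_mat_def sym_mats_dim)
  show s: "permute_mat \<sigma> A \<in> sym_mats n"
    unfolding eq by (rule sym_matsI) (use assms(1) lt sym_mats_sym in force)
  assume "e \<in> edges_on n"
  then obtain i j where ij: "i < n" "j < n" "e = {i, j}" by (auto simp: edges_on_iff)
  have "edge (permute_mat \<sigma> A) e = permute_mat \<sigma> A $$ (i, j)"
    using edge_doubleton[OF s] ij by simp
  also have "\<dots> = A $$ (\<sigma> i, \<sigma> j)" using ij by (simp add: eq)
  also have "\<dots> = edge A (\<sigma> ` e)" using edge_doubleton[OF assms(1), of "\<sigma> i" "\<sigma> j"] ij lt by simp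
  finally show "edge (permute_mat \<sigma> A) e = edge A (\<sigma> ` e)" .
qed

text \<open>Since \<open>permute_mat\<close> reads entries at the permuted indices, it moves edges
  by the inverse of \<open>\<sigma>\<close>. Pushing the result forward by \<open>\<sigma>\<close>
  recovers \<open>A\<close>, and the equation stays free of inverses.\<close>

lemma edge_mset_permute_mat:
  assumes "A \<in> sym_mats n" "\<sigma> permutes {..<n}"
  shows "image_mset (image \<sigma>) (edge_mset (permute_mat \<sigma> A)) = edge_mset A"
proof (rule image_mset_eqI[where S = "edges_on n"])
  have inj: "inj \<sigma>" using assms(2) by (simp add: permutes_inj)
  show "inj_on (image \<sigma>) (edges_on n)"
    by (rule inj_on_image_edges) (use inj in \<open>auto simp: inj_on_def\<close>)
  show "set_mset (edge_mset (permute_mat \<sigma> A)) \<subseteq> edges_on n"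
    using set_edge_mset[of "permute_mat \<sigma> A"] edge_permute_mat(1)[OF assms] by (simp add: sym_mats_dim)
  have *: "\<sigma> ` e \<in> edges_on n" if "e \<in> edges_on n" for e
    by (rule image_edges_on[OF _ that]) (simp add: permutes_image[OF assms(2)])
  show "set_mset (edge_mset A) \<subseteq> image \<sigma> ` edges_on n"
  proof
    fix e assume "e \<in># edge_mset A"
    then have "e \<in> edges_on n" using set_edge_mset[of A] assms sym_mats_dim by blast
    then obtain i j where "e = {i, j}" "i \<in> \<sigma> ` {..<n}" "j \<in> \<sigma> ` {..<n}"
      by (auto simp: edges_on_iff permutes_image[OF assms(2)])
    then obtain a b where "a < n" "b < n" "e = {\<sigma> a, \<sigma> b}" by blast
    then show "e \<in> image \<sigma> ` edges_on n" by (intro image_eqI[of _ _ "{a, b}"]) auto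
  qed
  fix e assume "e \<in> edges_on n"
  then show "count (edge_mset (permute_mat \<sigma> A)) e = count (edge_mset A) (\<sigma> ` e)"
    using * edge_permute_mat[OF assms] assms(1) by (simp add: count_edge_mset sym_mats_dim)
qed

lemma edge_zero_pad:
  assumes "A \<in> sym_mats n" "n \<le> N"
  shows "zero_pad N A \<in> sym_mats N"
    and "e \<in> edges_on N \<Longrightarrow> edge (zero_pad N A) e = (if e \<in> edges_on n then edge A e else 0)"
proof -
  have d: "dim_row A = n" "dim_col A = n" using assms by (auto simp: sym_mats_dim)
  have eq: "zero_pad N A = Matrix.mat N N (\<lambda>(i, j). if i < n \<and> j < n then A $$ (i, j) else 0)"
    using assms(2) by (intro eq_matI) (auto simp: zero_pad_def d Let_def)
  show s: "zero_pad N A \<in> sym_mats N"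
    unfolding eq by (rule sym_matsI) (use assms(1) sym_mats_sym in auto)
  assume "e \<in> edges_on N"
  then obtain i j where ij: "i < N" "j < N" "e = {i, j}" by (auto simp: edges_on_iff)
  have "edge (zero_pad N A) e = zero_pad N A $$ (i, j)"
    using edge_doubleton[OF s] ij by simp
  also have "\<dots> = (if i < n \<and> j < n then A $$ (i, j) else 0)" using ij by (simp add: eq)
  also have "\<dots> = (if e \<in> edges_on n then edge A e else 0)"
    using edge_doubleton[OF assms(1), of i j] ij edges_on_subset[of n] by auto
  finally show "edge (zero_pad N A) e = (if e \<in> edges_on n then edge A e else 0)" .
qed

lemma edge_mset_zero_pad:
  assumes "A \<in> sym_mats n" "n \<le> N"
  shows "edge_mset (zero_pad N A) = edge_mset A"
  by (rule multiset_eqI)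
    (use assms edge_zero_pad[OF assms] edges_on_mono[OF assms(2)] in \<open>auto simp: count_edge_mset sym_mats_dim\<close>)

text \<open>An entry of \<open>elem_sym\<close> tests whether the image of an edge is a given edge,
  so an entry of the quotient is a sum over a fibre of the induced map on edges. The diagonal value
  1 makes an edge that collapses to a loop count once. The entry type stays generic because both
  graphs and real matrices are divided.\<close>

lemma edge_quotient_mat:
  assumes "A \<in> sym_mats n" "f ` {..<n} \<subseteq> {..<k}"
  shows "quotient_mat k f A \<in> sym_mats k"
    and "e \<in> edges_on k \<Longrightarrow> edge (quotient_mat k f A) e = (\<Sum>e'\<in>{e'\<in>edges_on n. f ` e' = e}. edge A e')"
proof -
  have d: "dim_row A = n" using assms by (auto simp: sym_mats_dim)
  have entry: "quotient_mat k f A $$ (a, b) = (\<Sum>e'\<in>{e'\<in>edges_on n. f ` e' = {a, b}}. edge A e')"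
    if ab: "a < k" "b < k" for a b
  proof -
    have "quotient_mat k f A $$ (a, b) =
        (\<Sum>(i, j)\<in>upper_pairs n. edge A {i, j} * (if f ` {i, j} = {a, b} then 1 else 0))"
      using ab by (auto simp: quotient_mat_def d elem_sym_def edge_upper intro!: sum.cong)
    also have "\<dots> = (\<Sum>e'\<in>edges_on n. edge A e' * (if f ` e' = {a, b} then 1 else 0))"
      by (rule sum_upper_pairs)
    also have "\<dots> = (\<Sum>e'\<in>{e'\<in>edges_on n. f ` e' = {a, b}}. edge A e')"
      by (rule sum.mono_neutral_cong_right) auto
    finally show ?thesis .
  qed
  have eq: "quotient_mat k f A =
     Matrix.mat k k (\<lambda>(a, b). \<Sum>e'\<in>{e'\<in>edges_on n. f ` e' = {a, b}}. edge A e')"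
    by (rule eq_matI) (auto simp: entry, auto simp: quotient_mat_def)
  show s: "quotient_mat k f A \<in> sym_mats k"
    unfolding eq by (rule sym_matsI) (simp add: insert_commute)
  assume "e \<in> edges_on k"
  then obtain i j where ij: "i < k" "j < k" "e = {i, j}" by (auto simp: edges_on_iff)
  then show "edge (quotient_mat k f A) e = (\<Sum>e'\<in>{e'\<in>edges_on n. f ` e' = e}. edge A e')"
    using edge_doubleton[OF s] entry by simp
qed

lemma edge_mset_quotient_mat:
  assumes "A \<in> sym_mats n" "f ` {..<n} \<subseteq> {..<k}"
  shows "edge_mset (quotient_mat k f A) = image_mset (image f) (edge_mset A)"
proof (rule multiset_eqI)
  fix e
  have d: "dim_row A = n" "dim_row (quotient_mat k f A) = k"
    using assms edge_quotient_mat(1)[OF assms] by (auto simp: sym_mats_dim)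
  show "count (edge_mset (quotient_mat k f A)) e = count (image_mset (image f) (edge_mset A)) e"
  proof (cases "e \<in> edges_on k")
    case True
    have "count (image_mset (image f) (edge_mset A)) e = (\<Sum>e'\<in>{e'\<in>edges_on n. f ` e' = e}. edge A e')"
      unfolding count_image_mset
    proof (rule sum.mono_neutral_cong_left)
      show "image f -` {e} \<inter> set_mset (edge_mset A) \<subseteq> {e' \<in> edges_on n. f ` e' = e}"
        using set_edge_mset[of A] d by auto
      show "\<forall>i\<in>{e' \<in> edges_on n. f ` e' = e} - (`) f -` {e} \<inter> set_mset (edge_mset A). edge A i = 0"
        by (auto simp: not_in_iff count_edge_mset d intro: ccontr)
    qed (use d set_edge_mset[of A] in \<open>auto simp: count_edge_mset\<close>)
    then show ?thesis using True edge_quotient_mat(2)[OF assms True] d by (simp add: count_edge_mset)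
  next
    case False
    then have "e \<notin># image_mset (image f) (edge_mset A)"
      using image_edges_on[OF assms(2)] set_edge_mset[of A] d by auto
    then show ?thesis using False d by (simp add: count_edge_mset not_in_iff del: set_image_mset)
  qed
qed

lemma bij_betw_pick:
  assumes "finite V"
  shows "bij_betw (pick V) {..<card V} V"
proof -
  have inj: "inj_on (pick V) {..<card V}"
    by (rule linorder_inj_onI) (use pick_mono_le in fastforce)+
  have "pick V ` {..<card V} \<subseteq> V" using pick_in_set_le by auto
  moreover have "card (pick V ` {..<card V}) = card V" using inj by (simp add: card_image)
  ultimately show ?thesis using inj assms by (auto simp: bij_betw_def card_subset_eq)
qed

text \<open>\<open>submatrix\<close> renumbers the vertices through \<open>pick\<close>, their
  increasing enumeration, and this enumeration is the isomorphism from the reduced graph back to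
  \<open>H\<close>.\<close>

lemma remove_isolated:
  assumes "H \<in> sym_mats n"
  shows "remove_isolated H \<in> sym_mats (card (verts H))"
    and "image_mset (image (pick (verts H))) (edge_mset (remove_isolated H)) = edge_mset H"
proof -
  define V where "V = verts H"
  define p where "p = pick V"
  have V: "V \<subseteq> {..<n}" using assms by (auto simp: V_def verts_def sym_mats_dim)
  then have fV: "finite V" by (rule finite_subset) simp
  have bp: "bij_betw p {..<card V} V" unfolding p_def using fV by (rule bij_betw_pick)
  have d: "dim_row H = n" "dim_col H = n" using assms by (auto simp: sym_mats_dim)
  have VV: "{i. i < n \<and> i \<in> V} = V" using V by auto
  have pV: "p i < n" if "i < card V" for i using that bp V by (auto simp: bij_betw_def)
  have eq: "remove_isolated H = Matrix.mat (card V) (card V) (\<lambda>(i, j). H $$ (p i, p j))"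
    unfolding remove_isolated_def submatrix_def V_def[symmetric] p_def d VV ..
  have s: "remove_isolated H \<in> sym_mats (card V)"
    unfolding eq by (rule sym_matsI) (use assms pV sym_mats_sym in force)
  then show "remove_isolated H \<in> sym_mats (card (verts H))" by (simp add: V_def)
  have ds: "dim_row (remove_isolated H) = card V" using s by (simp add: sym_mats_dim)
  have pn: "p ` {..<card V} \<subseteq> {..<n}" using pV by auto
  have "image_mset (image p) (edge_mset (remove_isolated H)) = edge_mset H"
  proof (rule image_mset_eqI[where S = "edges_on (card V)"])
    show "inj_on (image p) (edges_on (card V))"
      by (rule inj_on_image_edges) (use bp in \<open>auto simp: bij_betw_def\<close>)
    show "set_mset (edge_mset (remove_isolated H)) \<subseteq> edges_on (card V)"
      using set_edge_mset[of "remove_isolated H"] by (simp add: ds)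
    show "set_mset (edge_mset H) \<subseteq> image p ` edges_on (card V)"
    proof
      fix e assume e: "e \<in># edge_mset H"
      then obtain i j where ij: "e = {i, j}"
        using set_edge_mset[of H] by (force simp: edges_on_iff)
      have "e \<subseteq> V" using e verts_eq[OF assms] by (auto simp: V_def)
      then have "i \<in> p ` {..<card V}" "j \<in> p ` {..<card V}" using bp ij by (auto simp: bij_betw_def)
      then obtain a b where "a < card V" "b < card V" "i = p a" "j = p b" by blast
      then show "e \<in> image p ` edges_on (card V)"
        using ij by (intro image_eqI[of _ _ "{a, b}"]) auto
    qed
    fix e assume e: "e \<in> edges_on (card V)"
    then obtain i j where ij: "i < card V" "j < card V" "e = {i, j}" by (auto simp: edges_on_iff)
    have "edge (remove_isolated H) e = H $$ (p i, p j)"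
      using edge_doubleton[OF s, of i j] ij by (simp add: eq)
    also have "\<dots> = edge H (p ` e)" using edge_doubleton[OF assms, of "p i" "p j"] ij pV by simp
    finally show "count (edge_mset (remove_isolated H)) e = count (edge_mset H) (p ` e)"
      using e image_edges_on[OF pn e] by (simp add: count_edge_mset ds d)
  qed
  then show "image_mset (image (pick (verts H))) (edge_mset (remove_isolated H)) = edge_mset H"
    by (simp add: p_def V_def)
qed

section \<open>Isomorphism classes and symmetrised monomials\<close>

lemma supp_image: "supp (image_mset (image f) A) = f ` supp A"
  by auto

lemma image_mset_image_cong:
  "(\<And>x. x \<in> supp A \<Longrightarrow> f x = g x) \<Longrightarrow> image_mset (image f) A = image_mset (image g) A"
  by (intro image_mset_cong image_cong) auto

lemma image_mset_image_comp:
  "image_mset (image g) (image_mset (image f) A) = image_mset (image (g \<circ> f)) A"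
  by (simp add: multiset.map_comp o_def image_image)

lemma image_mset_image_id:
  "(\<And>x. x \<in> supp A \<Longrightarrow> f x = x) \<Longrightarrow> image_mset (image f) A = A"
  using image_mset_image_cong[of A f id] by simp

text \<open>Injectivity is asked on the vertices only and no ambient size is mentioned. Because the
  image is all of \<open>B\<close>, such a map is automatically a bijection between the two vertex
  sets, which makes the relation symmetric.\<close>

definition mset_iso :: "nat set multiset \<Rightarrow> nat set multiset \<Rightarrow> bool" where
  "mset_iso A B \<longleftrightarrow> (\<exists>f. inj_on f (supp A) \<and> image_mset (image f) A = B)"

lemma mset_isoI: "inj_on f (supp A) \<Longrightarrow> image_mset (image f) A = B \<Longrightarrow> mset_iso A B"
  by (auto simp: mset_iso_def)

lemma mset_iso_refl [simp]: "mset_iso A A"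
  by (rule mset_isoI[of id]) auto

lemma mset_iso_sym:
  assumes "mset_iso A B"
  shows "mset_iso B A"
proof -
  obtain f where f: "inj_on f (supp A)" "B = image_mset (image f) A"
    using assms by (auto simp: mset_iso_def)
  let ?g = "the_inv_into (supp A) f"
  have "image_mset (image ?g) B = A"
    unfolding f(2) image_mset_image_comp
    by (rule image_mset_image_id) (simp add: the_inv_into_f_f[OF f(1)])
  moreover have "inj_on ?g (supp B)"
    using inj_on_the_inv_into[OF f(1)] unfolding f(2) supp_image .
  ultimately show ?thesis by (rule mset_isoI[rotated])
qed

lemma mset_iso_trans:
  assumes "mset_iso A B" "mset_iso B C"
  shows "mset_iso A C"
proof -
  obtain f where f: "inj_on f (supp A)" "B = image_mset (image f) A"
    using assms(1) by (auto simp: mset_iso_def)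
  obtain g where g: "inj_on g (supp B)" "C = image_mset (image g) B"
    using assms(2) by (auto simp: mset_iso_def)
  have "inj_on (g \<circ> f) (supp A)"
    by (rule comp_inj_on[OF f(1)]) (use g(1) in \<open>simp only: f(2) supp_image\<close>)
  moreover have "image_mset (image (g \<circ> f)) A = C"
    by (simp only: f(2) g(2) image_mset_image_comp)
  ultimately show ?thesis by (rule mset_isoI)
qed

lemma mset_iso_card: "mset_iso A B \<Longrightarrow> card (supp A) = card (supp B)"
  unfolding mset_iso_def by (metis card_image supp_image)

lemma mset_iso_size: "mset_iso A B \<Longrightarrow> size A = size B"
  unfolding mset_iso_def by auto

lemma mset_iso_fact:
  assumes "mset_iso A B"
  shows "mset_fact A = mset_fact B"
proof -
  obtain f where f: "inj_on f (supp A)" "B = image_mset (image f) A"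
    using assms by (auto simp: mset_iso_def)
  have inj: "inj_on (image f) (set_mset A)"
    by (rule inj_on_subset[OF inj_on_image_Pow[OF f(1)]]) auto
  have "count B (f ` e) = count A e" if "e \<in># A" for e
  proof -
    have "image f -` {f ` e} \<inter> set_mset A = {e}" using inj that by (auto simp: inj_on_def)
    then show ?thesis by (simp add: f(2) count_image_mset)
  qed
  then show ?thesis
    unfolding mset_fact_def by (simp add: f(2) prod.reindex[OF inj])
qed

text \<open>Inside a finite set the complements of \<open>T\<close> and of its image have the same
  size, so any bijection between them fills the gap.\<close>

lemma extend_to_permutation:
  assumes "finite S" "T \<subseteq> S" "inj_on f T" "f ` T \<subseteq> S"
  obtains \<tau> where "\<tau> permutes S" "\<And>x. x \<in> T \<Longrightarrow> \<tau> x = f x"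
proof -
  have fin: "finite T" using assms finite_subset by blast
  have "card (S - T) = card (S - f ` T)"
    using assms fin by (simp add: card_Diff_subset card_image)
  then obtain h where h: "bij_betw h (S - T) (S - f ` T)"
    using finite_same_card_bij assms(1) by (metis finite_Diff)
  define \<tau> where "\<tau> x = (if x \<in> T then f x else if x \<in> S then h x else x)" for x
  have "bij_betw \<tau> T (f ` T)"
    using assms(3) by (auto simp: bij_betw_def \<tau>_def inj_on_def)
  moreover have "bij_betw \<tau> (S - T) (S - f ` T)"
    using h by (subst bij_betw_cong[of _ _ h]) (auto simp: \<tau>_def)
  ultimately have "bij_betw \<tau> (T \<union> (S - T)) (f ` T \<union> (S - f ` T))"
    by (rule bij_betw_combine) auto
  moreover have "T \<union> (S - T) = S" "f ` T \<union> (S - f ` T) = S" using assms by auto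
  ultimately have "bij_betw \<tau> S S" by simp
  then have "\<tau> permutes S"
    by (rule bij_imp_permutes) (use assms(2) in \<open>auto simp: \<tau>_def\<close>)
  then show thesis using that by (auto simp: \<tau>_def)
qed

text \<open>An isomorphism is only a partial injection of \<open>{..<n}\<close>; extending it to a
  permutation turns isomorphism into membership in the orbit.\<close>

lemma perm_orbit_eq:
  assumes "A \<in> sym_mats n"
  shows "perm_orbit n A = {M \<in> sym_mats n. mset_iso (edge_mset A) (edge_mset M)}"
proof (intro equalityI subsetI)
  fix M assume "M \<in> perm_orbit n A"
  then obtain \<sigma> where s: "\<sigma> permutes {..<n}" "M = permute_mat \<sigma> A" by (auto simp: perm_orbit_def)
  have "mset_iso (edge_mset M) (edge_mset A)"
    by (rule mset_isoI[of \<sigma>])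
      (use edge_mset_permute_mat[OF assms s(1)] s permutes_inj_on in auto)
  then show "M \<in> {M \<in> sym_mats n. mset_iso (edge_mset A) (edge_mset M)}"
    using edge_permute_mat(1)[OF assms s(1)] s(2) by (auto intro: mset_iso_sym)
next
  fix M assume "M \<in> {M \<in> sym_mats n. mset_iso (edge_mset A) (edge_mset M)}"
  then obtain f where M: "M \<in> sym_mats n" and f: "inj_on f (supp (edge_mset A))"
    "image_mset (image f) (edge_mset A) = edge_mset M" by (auto simp: mset_iso_def)
  have "f ` supp (edge_mset A) = supp (edge_mset M)" using f(2) by (metis supp_image)
  then have "f ` supp (edge_mset A) \<subseteq> {..<n}"
    using supp_edge_mset_subset[of M] M by (simp add: sym_mats_dim)
  moreover have "supp (edge_mset A) \<subseteq> {..<n}"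
    using supp_edge_mset_subset[of A] assms by (simp add: sym_mats_dim)
  ultimately obtain \<tau> where \<tau>: "\<tau> permutes {..<n}" "\<And>x. x \<in> supp (edge_mset A) \<Longrightarrow> \<tau> x = f x"
    using extend_to_permutation[OF finite_lessThan _ f(1)] by metis
  \<comment> \<open>The inverse is taken because \<open>permute_mat\<close> moves edges
    backwards.\<close>
  let ?s = "inv_into UNIV \<tau>"
  have s: "?s permutes {..<n}" using \<tau>(1) by (rule permutes_inv)
  have "edge_mset (permute_mat ?s A) =
      image_mset (image \<tau>) (image_mset (image ?s) (edge_mset (permute_mat ?s A)))"
    unfolding image_mset_image_comp using \<tau>(1)
    by (intro image_mset_image_id[symmetric]) (simp add: permutes_inverses)
  also have "\<dots> = image_mset (image \<tau>) (edge_mset A)"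
    by (simp only: edge_mset_permute_mat[OF assms s])
  also have "\<dots> = edge_mset M"
    unfolding f(2)[symmetric] by (rule image_mset_image_cong) (rule \<tau>(2))
  finally have "permute_mat ?s A = M"
    by (intro edge_mset_inj[OF edge_permute_mat(1)[OF assms s] M])
  then show "M \<in> perm_orbit n A" using s by (auto simp: perm_orbit_def)
qed

lemma is_graphI: "H \<in> sym_mats n \<Longrightarrow> is_graph H"
  by (simp add: is_graph_def sym_mats_dim)

text \<open>Renumbering preserves the number of vertices, and the new ones lie in an initial segment
  of exactly that size, so they fill it. Maps on \<open>{..<card (verts H)}\<close> can therefore be
  read as maps on the vertices.\<close>

lemma is_graph_remove_isolated:
  assumes "is_graph H"
  shows "remove_isolated H \<in> sym_mats (card (verts H))"
    and "mset_iso (edge_mset (remove_isolated H)) (edge_mset H)"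
    and "supp (edge_mset (remove_isolated H)) = {..<card (verts H)}"
proof -
  have H: "H \<in> sym_mats (dim_row H)" using assms by (simp add: is_graph_def)
  show s: "remove_isolated H \<in> sym_mats (card (verts H))" by (rule remove_isolated(1)[OF H])
  have sub: "supp (edge_mset (remove_isolated H)) \<subseteq> {..<card (verts H)}"
    using supp_edge_mset_subset[of "remove_isolated H"] s by (simp add: sym_mats_dim)
  have "finite (verts H)" by (simp add: verts_eq[OF H])
  then have "inj_on (pick (verts H)) {..<card (verts H)}"
    using bij_betw_pick by (auto simp: bij_betw_def)
  then show i: "mset_iso (edge_mset (remove_isolated H)) (edge_mset H)"
    by (rule mset_isoI[OF inj_on_subset[OF _ sub] remove_isolated(2)[OF H]])
  show "supp (edge_mset (remove_isolated H)) = {..<card (verts H)}"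
    by (rule card_subset_eq[OF _ sub]) (simp_all add: mset_iso_card[OF i] verts_eq[OF H])
qed

lemma verts_graph: "is_graph H \<Longrightarrow> verts H = supp (edge_mset H)"
  unfolding is_graph_def by (rule verts_eq)

lemma mset_iso_iff:
  "mset_iso A B \<Longrightarrow> mset_iso A C \<longleftrightarrow> mset_iso B C"
  by (meson mset_iso_sym mset_iso_trans)

lemma iso_class_eq:
  assumes "is_graph H"
  shows "iso_class H = {G \<in> sym_mats (card (verts H)). mset_iso (edge_mset H) (edge_mset G)}"
  unfolding iso_class_def perm_orbit_eq[OF is_graph_remove_isolated(1)[OF assms]]
  using mset_iso_iff[OF is_graph_remove_isolated(2)[OF assms]] by blast

lemma padded_orbit_eq:
  assumes "is_graph H" "card (verts H) \<le> n"
  shows "perm_orbit n (zero_pad n (remove_isolated H)) =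
    {M \<in> sym_mats n. mset_iso (edge_mset H) (edge_mset M)}"
proof -
  note r = is_graph_remove_isolated[OF assms(1)]
  show ?thesis
    unfolding perm_orbit_eq[OF edge_zero_pad(1)[OF r(1) assms(2)]] edge_mset_zero_pad[OF r(1) assms(2)]
    using mset_iso_iff[OF r(2)] by blast
qed

lemma iso_class_eq_iff:
  assumes "is_graph H" "is_graph G"
  shows "iso_class H = iso_class G \<longleftrightarrow> mset_iso (edge_mset H) (edge_mset G)"
proof
  assume i: "mset_iso (edge_mset H) (edge_mset G)"
  show "iso_class H = iso_class G"
    using mset_iso_iff[OF i] mset_iso_card[OF i]
    by (simp add: iso_class_eq[OF assms(1)] iso_class_eq[OF assms(2)] verts_graph assms)
next
  assume eq: "iso_class H = iso_class G"
  have "remove_isolated H \<in> iso_class H"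
    using is_graph_remove_isolated(1)[OF assms(1)] mset_iso_sym[OF is_graph_remove_isolated(2)[OF assms(1)]]
    by (simp add: iso_class_eq[OF assms(1)])
  then have "mset_iso (edge_mset G) (edge_mset (remove_isolated H))"
    by (simp add: eq iso_class_eq[OF assms(2)])
  then show "mset_iso (edge_mset H) (edge_mset G)"
    using is_graph_remove_isolated[OF assms(1)] mset_iso_sym mset_iso_trans by blast
qed

text \<open>The choice is legitimate because the class contains the graph stripped of its isolated
  vertices. Anything invariant under \<open>mset_iso\<close> then passes from \<open>H\<close> to
  the representative.\<close>

lemma rep_iso_class:
  assumes "is_graph H"
  shows "rep (iso_class H) \<in> sym_mats (card (verts H))"
    and "mset_iso (edge_mset H) (edge_mset (rep (iso_class H)))"
proof -
  have "remove_isolated H \<in> iso_class H"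
    using is_graph_remove_isolated(1)[OF assms] mset_iso_sym[OF is_graph_remove_isolated(2)[OF assms]]
    by (simp add: iso_class_eq[OF assms])
  then have "rep (iso_class H) \<in> iso_class H" unfolding rep_def by (rule someI)
  then show "rep (iso_class H) \<in> sym_mats (card (verts H))"
    and "mset_iso (edge_mset H) (edge_mset (rep (iso_class H)))"
    by (simp_all add: iso_class_eq[OF assms])
qed

lemma iso_class_rep:
  assumes "C \<in> iso_classes"
  shows "is_graph (rep C)" "iso_class (rep C) = C" "rep C \<in> sym_mats (card (verts (rep C)))"
proof -
  obtain H where H: "is_graph H" "C = iso_class H" using assms by (auto simp: iso_classes_def)
  note r = rep_iso_class[OF H(1)]
  show g: "is_graph (rep C)" using r(1) H(2) is_graphI by blast
  show "iso_class (rep C) = C" using mset_iso_sym[OF r(2)] iso_class_eq_iff[OF g H(1)] H(2) by simp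
  show "rep C \<in> sym_mats (card (verts (rep C)))"
    using r(1) mset_iso_card[OF r(2)] H g by (simp add: verts_graph)
qed

section \<open>Finiteness, and grouping monomials by isomorphism class\<close>

text \<open>The exponents of the monomials of degree at most \<open>d\<close> in the entries of a
  symmetric matrix of size \<open>n\<close>.\<close>

definition graphs_upto :: "nat \<Rightarrow> nat \<Rightarrow> nat mat set" where
  "graphs_upto n d = {G \<in> sym_mats n. num_edges G \<le> d}"

lemma finite_graphs_upto [simp]: "finite (graphs_upto n d)"
proof -
  have inj: "inj_on edge_mset (graphs_upto n d)"
    by (auto simp: inj_on_def graphs_upto_def intro: edge_mset_inj)
  have "edge_mset ` graphs_upto n d \<subseteq> mset ` {xs. set xs \<subseteq> edges_on n \<and> length xs \<le> d}"
  proof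
    fix A assume "A \<in> edge_mset ` graphs_upto n d"
    then have A: "set_mset A \<subseteq> edges_on n" "size A \<le> d"
      using set_edge_mset by (fastforce simp: graphs_upto_def num_edges_eq sym_mats_dim)+
    obtain xs where "A = mset xs" by (metis ex_mset)
    then show "A \<in> mset ` {xs. set xs \<subseteq> edges_on n \<and> length xs \<le> d}" using A by auto
  qed
  then have "finite (edge_mset ` graphs_upto n d)"
    by (rule finite_subset) (simp add: finite_lists_length_le)
  then show ?thesis using inj by (rule finite_imageD)
qed

text \<open>An edge has at most two endpoints. Every occurrence of the constant \<open>2 * d\<close>
  goes back to this bound.\<close>

lemma card_supp_le: "G \<in> sym_mats n \<Longrightarrow> card (supp (edge_mset G)) \<le> 2 * size (edge_mset G)"
proof -
  assume G: "G \<in> sym_mats n"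
  have "card (supp A) \<le> 2 * size A" if "set_mset A \<subseteq> edges_on n" for A
    using that
  proof (induction A)
    case (add e A)
    have "card e \<le> 2" using add.prems by (auto simp: edges_on_iff card_insert_if)
    have "card (e \<union> supp A) \<le> card e + card (supp A)" by (rule card_Un_le)
    also have "\<dots> \<le> 2 + 2 * size A" using add \<open>card e \<le> 2\<close> by (intro add_mono) auto
    finally show ?case by simp
  qed simp
  then show ?thesis using set_edge_mset[of G] G by (simp add: sym_mats_dim)
qed

lemma iso_classes_upto_rep:
  assumes "C \<in> iso_classes_upto d"
  shows "C \<in> iso_classes" "num_edges (rep C) \<le> d" "card (verts (rep C)) \<le> 2 * d"
proof -
  obtain H where H: "is_graph H" "C = iso_class H" "num_edges H \<le> d"
    using assms by (auto simp: iso_classes_upto_def)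
  show C: "C \<in> iso_classes" using H by (auto simp: iso_classes_def)
  show n: "num_edges (rep C) \<le> d"
    using H mset_iso_size[OF rep_iso_class(2)[OF H(1)]] by (simp add: num_edges_eq)
  show "card (verts (rep C)) \<le> 2 * d"
    using card_supp_le[OF iso_class_rep(3)[OF C]] n verts_graph[OF iso_class_rep(1)[OF C]]
    by (simp add: num_edges_eq)
qed

lemma iso_class_upto:
  "M \<in> graphs_upto n d \<Longrightarrow> iso_class M \<in> iso_classes_upto d"
  unfolding graphs_upto_def iso_classes_upto_def using is_graphI by blast

lemma finite_iso_classes_upto [simp]: "finite (iso_classes_upto d)"
proof (rule finite_subset)
  show "iso_classes_upto d \<subseteq> iso_class ` (\<Union>v\<in>{..2 * d}. graphs_upto v d)"
  proof
    fix C assume C: "C \<in> iso_classes_upto d"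
    note r = iso_classes_upto_rep[OF C]
    have "rep C \<in> graphs_upto (card (verts (rep C))) d"
      using iso_class_rep(3)[OF r(1)] r(2) by (simp add: graphs_upto_def)
    then show "C \<in> iso_class ` (\<Union>v\<in>{..2 * d}. graphs_upto v d)"
      using r(3) iso_class_rep(2)[OF r(1)] by (intro image_eqI[of _ _ "rep C"]) auto
  qed
qed simp

text \<open>If \<open>n\<close> is too small, no graph on \<open>n\<close> points is isomorphic to
  \<open>H\<close>; the empty sum agrees with the convention that the polynomial is zero, so later
  arguments need no case distinction.\<close>

lemma sym_monomial_eq:
  assumes "is_graph H"
  shows "sym_monomial H n X = (\<Sum>M\<in>{M \<in> sym_mats n. mset_iso (edge_mset H) (edge_mset M)}. mat_monomial M X)"
proof (cases "card (verts H) \<le> n")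
  case True
  then show ?thesis by (simp add: sym_monomial_def padded_orbit_eq[OF assms])
next
  case False
  have False if "M \<in> sym_mats n" "mset_iso (edge_mset H) (edge_mset M)" for M
  proof -
    have "card (supp (edge_mset M)) \<le> card {..<n}"
      using supp_edge_mset_subset[of M] that(1) by (intro card_mono) (auto simp: sym_mats_dim)
    then show False using False mset_iso_card[OF that(2)] by (simp add: verts_graph[OF assms])
  qed
  then have "{M \<in> sym_mats n. mset_iso (edge_mset H) (edge_mset M)} = {}" by blast
  then show ?thesis using False by (simp only: sym_monomial_def if_False sum.empty)
qed

lemma sym_monomial_rep:
  assumes "C \<in> iso_classes_upto d"
  shows "sym_monomial (rep C) n X = (\<Sum>M\<in>{M \<in> graphs_upto n d. iso_class M = C}. mat_monomial M X)"
proof -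
  note r = iso_classes_upto_rep[OF assms]
  note g = iso_class_rep[OF r(1)]
  have "M \<in> sym_mats n \<and> mset_iso (edge_mset (rep C)) (edge_mset M) \<longleftrightarrow>
      M \<in> graphs_upto n d \<and> iso_class M = C" for M
  proof -
    have "iso_class (rep C) = iso_class M \<longleftrightarrow> mset_iso (edge_mset (rep C)) (edge_mset M)"
      if "M \<in> sym_mats n"
      using that by (intro iso_class_eq_iff g is_graphI)
    then show ?thesis using r(2) mset_iso_size by (auto simp: g(2) graphs_upto_def num_edges_eq)
  qed
  then show ?thesis unfolding sym_monomial_eq[OF g(1)] by (intro sum.cong) auto
qed

text \<open>The sum is grouped by the fibres of \<open>iso_class\<close>, each of which adds up to
  one \<open>sym_monomial\<close>.\<close>

lemma sum_over_classes:
  "(\<Sum>M\<in>graphs_upto n d. c (iso_class M) * mat_monomial M X) =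
   (\<Sum>C\<in>iso_classes_upto d. c C * sym_monomial (rep C) n X)"
proof -
  have "(\<Sum>M\<in>graphs_upto n d. c (iso_class M) * mat_monomial M X) =
      (\<Sum>C\<in>iso_classes_upto d. \<Sum>M\<in>{M \<in> graphs_upto n d. iso_class M = C}.
        c (iso_class M) * mat_monomial M X)"
    by (rule sum.group[symmetric]) (auto simp: iso_class_upto)
  also have "\<dots> = (\<Sum>C\<in>iso_classes_upto d. c C * sym_monomial (rep C) n X)"
    by (intro sum.cong) (simp_all add: sym_monomial_rep sum_distrib_left)
  finally show ?thesis .
qed

text \<open>Surjectivity onto \<open>supp B\<close>, demanded of refinement maps, is automatic here.\<close>

definition num_maps :: "nat set multiset \<Rightarrow> nat set multiset \<Rightarrow> nat" where
  "num_maps A B = card {f \<in> extensional (supp A). image_mset (image f) A = B}"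

text \<open>Postcomposition with \<open>b\<close> is undone by the inverse of \<open>b\<close> on
  its image, because every map counted on the left sends the vertices of \<open>A\<close> exactly
  onto that image.\<close>

lemma num_maps_image_right:
  assumes "inj_on b (supp B)"
  shows "num_maps A (image_mset (image b) B) = num_maps A B"
proof -
  let ?b' = "the_inv_into (supp B) b"
  have "bij_betw (\<lambda>f. restrict (b \<circ> f) (supp A))
     {f \<in> extensional (supp A). image_mset (image f) A = B}
     {f \<in> extensional (supp A). image_mset (image f) A = image_mset (image b) B}"
  proof (rule bij_betw_byWitness[where f' = "\<lambda>f. restrict (?b' \<circ> f) (supp A)"])
    show "\<forall>f\<in>{f \<in> extensional (supp A). image_mset (image f) A = B}.
       restrict (?b' \<circ> restrict (b \<circ> f) (supp A)) (supp A) = f"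
    proof
      fix f assume f: "f \<in> {f \<in> extensional (supp A). image_mset (image f) A = B}"
      then have "f ` supp A = supp B" using supp_image by blast
      then show "restrict (?b' \<circ> restrict (b \<circ> f) (supp A)) (supp A) = f"
        using f the_inv_into_f_f[OF assms] by (intro extensionalityI[of _ "supp A"]) auto
    qed
    show "\<forall>f\<in>{f \<in> extensional (supp A). image_mset (image f) A = image_mset (image b) B}.
       restrict (b \<circ> restrict (?b' \<circ> f) (supp A)) (supp A) = f"
    proof
      fix f assume f: "f \<in> {f \<in> extensional (supp A). image_mset (image f) A = image_mset (image b) B}"
      then have "f ` supp A = b ` supp B"
        using supp_image[of f A] supp_image[of b B] by (simp only: mem_Collect_eq)
      then show "restrict (b \<circ> restrict (?b' \<circ> f) (supp A)) (supp A) = f"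
        using f f_the_inv_into_f[OF assms] by (intro extensionalityI[of _ "supp A"]) auto
    qed
    show "(\<lambda>f. restrict (b \<circ> f) (supp A)) ` {f \<in> extensional (supp A). image_mset (image f) A = B}
      \<subseteq> {f \<in> extensional (supp A). image_mset (image f) A = image_mset (image b) B}"
    proof (intro image_subsetI CollectI conjI)
      fix f assume f: "f \<in> {f \<in> extensional (supp A). image_mset (image f) A = B}"
      have "image_mset (image (restrict (b \<circ> f) (supp A))) A = image_mset (image (b \<circ> f)) A"
        by (rule image_mset_image_cong) simp
      then show "image_mset (image (restrict (b \<circ> f) (supp A))) A = image_mset (image b) B"
        using f by (simp add: image_mset_image_comp[symmetric])
    qed simp
    show "(\<lambda>f. restrict (?b' \<circ> f) (supp A)) `
        {f \<in> extensional (supp A). image_mset (image f) A = image_mset (image b) B}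
      \<subseteq> {f \<in> extensional (supp A). image_mset (image f) A = B}"
    proof (intro image_subsetI CollectI conjI)
      fix f assume f: "f \<in> {f \<in> extensional (supp A). image_mset (image f) A = image_mset (image b) B}"
      have "image_mset (image (restrict (?b' \<circ> f) (supp A))) A = image_mset (image (?b' \<circ> f)) A"
        by (rule image_mset_image_cong) simp
      also have "\<dots> = image_mset (image ?b') (image_mset (image b) B)"
        using f by (simp add: image_mset_image_comp[symmetric])
      also have "\<dots> = B"
        unfolding image_mset_image_comp
        by (rule image_mset_image_id) (simp add: the_inv_into_f_f[OF assms])
      finally show "image_mset (image (restrict (?b' \<circ> f) (supp A))) A = B" .
    qed simp
  qed
  from bij_betw_same_card[OF this] show ?thesis unfolding num_maps_def by (rule sym)
qed

text \<open>The dual count, by precomposition with \<open>a\<close>; restricting to the supports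
  keeps the maps extensional.\<close>

lemma num_maps_image_left:
  assumes "inj_on a (supp A)"
  shows "num_maps (image_mset (image a) A) B = num_maps A B"
proof -
  let ?a' = "the_inv_into (supp A) a"
  let ?A' = "image_mset (image a) A"
  have *: "image_mset (image ?a') ?A' = A"
    unfolding image_mset_image_comp
    by (rule image_mset_image_id) (simp add: the_inv_into_f_f[OF assms])
  have "bij_betw (\<lambda>f. restrict (f \<circ> a) (supp A))
     {f \<in> extensional (supp ?A'). image_mset (image f) ?A' = B}
     {f \<in> extensional (supp A). image_mset (image f) A = B}"
  proof (rule bij_betw_byWitness[where f' = "\<lambda>f. restrict (f \<circ> ?a') (supp ?A')"])
    show "\<forall>f\<in>{f \<in> extensional (supp ?A'). image_mset (image f) ?A' = B}.
       restrict (restrict (f \<circ> a) (supp A) \<circ> ?a') (supp ?A') = f"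
    proof (intro ballI extensionalityI[of _ "supp ?A'"])
      fix f y
      assume "y \<in> supp ?A'"
      then obtain x where x: "x \<in> supp A" "y = a x" unfolding supp_image by blast
      have "y \<in> supp ?A'" by fact
      then show "restrict (restrict (f \<circ> a) (supp A) \<circ> ?a') (supp ?A') y = f y"
        using x the_inv_into_f_f[OF assms x(1)] by (simp del: set_image_mset)
    qed simp_all
    show "\<forall>f\<in>{f \<in> extensional (supp A). image_mset (image f) A = B}.
       restrict (restrict (f \<circ> ?a') (supp ?A') \<circ> a) (supp A) = f"
      using the_inv_into_f_f[OF assms]
      by (intro ballI extensionalityI[of _ "supp A"]) auto
    show "(\<lambda>f. restrict (f \<circ> a) (supp A)) ` {f \<in> extensional (supp ?A'). image_mset (image f) ?A' = B}
      \<subseteq> {f \<in> extensional (supp A). image_mset (image f) A = B}"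
    proof (intro image_subsetI CollectI conjI)
      fix f assume f: "f \<in> {f \<in> extensional (supp ?A'). image_mset (image f) ?A' = B}"
      have "image_mset (image (restrict (f \<circ> a) (supp A))) A = image_mset (image (f \<circ> a)) A"
        by (rule image_mset_image_cong) simp
      then show "image_mset (image (restrict (f \<circ> a) (supp A))) A = B"
        using f by (simp add: image_mset_image_comp[symmetric])
    qed simp
    show "(\<lambda>f. restrict (f \<circ> ?a') (supp ?A')) ` {f \<in> extensional (supp A). image_mset (image f) A = B}
      \<subseteq> {f \<in> extensional (supp ?A'). image_mset (image f) ?A' = B}"
    proof (intro image_subsetI CollectI conjI)
      fix f assume f: "f \<in> {f \<in> extensional (supp A). image_mset (image f) A = B}"
      have "image_mset (image (restrict (f \<circ> ?a') (supp ?A'))) ?A' = image_mset (image (f \<circ> ?a')) ?A'"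
        by (rule image_mset_image_cong) simp
      also have "\<dots> = image_mset (image f) (image_mset (image ?a') ?A')"
        by (rule image_mset_image_comp[symmetric])
      finally show "image_mset (image (restrict (f \<circ> ?a') (supp ?A'))) ?A' = B"
        using f by (simp only: * mem_Collect_eq)
    qed simp
  qed
  from bij_betw_same_card[OF this] show ?thesis unfolding num_maps_def .
qed

text \<open>This makes the refinement count a function of two isomorphism classes, to be evaluated
  on whichever representatives are at hand.\<close>

lemma num_maps_iso:
  assumes "mset_iso A A'" "mset_iso B B'"
  shows "num_maps A B = num_maps A' B'"
proof -
  obtain a where a: "inj_on a (supp A)" "A' = image_mset (image a) A"
    using assms(1) by (auto simp: mset_iso_def)
  obtain b where b: "inj_on b (supp B)" "B' = image_mset (image b) B"
    using assms(2) by (auto simp: mset_iso_def)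
  show ?thesis unfolding a(2) b(2) num_maps_image_left[OF a(1)] num_maps_image_right[OF b(1)] ..
qed

lemma refinement_maps_eq:
  assumes "is_graph G" "is_graph H"
  shows "refinement_maps G H = {f \<in> extensional (supp (edge_mset (remove_isolated G))).
    image_mset (image f) (edge_mset (remove_isolated G)) = edge_mset (remove_isolated H)}"
    (is "_ = ?R")
proof -
  note g = is_graph_remove_isolated[OF assms(1)]
  note h = is_graph_remove_isolated[OF assms(2)]
  show ?thesis
  proof (intro equalityI subsetI)
    fix f assume f: "f \<in> refinement_maps G H"
    then have "f ` {..<card (verts G)} \<subseteq> {..<card (verts H)}" by (auto simp: refinement_maps_def)
    from edge_mset_quotient_mat[OF g(1) this] f show "f \<in> ?R"
      by (auto simp: refinement_maps_def g(3) PiE_def)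
  next
    fix f assume f: "f \<in> ?R"
    then have im: "f ` {..<card (verts G)} = {..<card (verts H)}"
      using supp_image[of f "edge_mset (remove_isolated G)"] by (simp only: mem_Collect_eq g(3) h(3))
    then have sub: "f ` {..<card (verts G)} \<subseteq> {..<card (verts H)}" by simp
    have "quotient_mat (card (verts H)) f (remove_isolated G) = remove_isolated H"
      by (rule edge_mset_inj[OF edge_quotient_mat(1)[OF g(1) sub] h(1)])
        (use f in \<open>simp add: edge_mset_quotient_mat[OF g(1) sub]\<close>)
    then show "f \<in> refinement_maps G H"
      using f im by (auto simp: refinement_maps_def g(3) PiE_def)
  qed
qed

lemma num_refinements_eq:
  assumes "is_graph G" "is_graph H"
  shows "num_refinements G H = num_maps (edge_mset G) (edge_mset H)"
  unfolding num_refinements_def refinement_maps_eq[OF assms] num_maps_def[symmetric]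
  by (rule num_maps_iso) (rule is_graph_remove_isolated assms)+

section \<open>Homomorphism, injection and expectation polynomials\<close>

lemma maps_PiE:
  assumes "supp B \<subseteq> T"
  shows "{f \<in> supp A \<rightarrow>\<^sub>E T. image_mset (image f) A = B} =
    {f \<in> extensional (supp A). image_mset (image f) A = B}"
proof -
  have "f ` supp A \<subseteq> T" if "image_mset (image f) A = B" for f
    using assms supp_image[of f A] that by simp
  then show ?thesis by (auto simp: PiE_def)
qed

text \<open>Points of \<open>S\<close> that are not vertices of \<open>A\<close> do not influence
  the image, so their values are free. This is the source of the power of \<open>k\<close> in the
  expectation formula.\<close>

lemma card_maps_superset:
  assumes "finite S" "supp A \<subseteq> S" "supp B \<subseteq> T" "finite T"
  shows "card {f \<in> S \<rightarrow>\<^sub>E T. image_mset (image f) A = B} =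
    card T ^ (card S - card (supp A)) * num_maps A B"
proof -
  let ?U = "supp A"
  have "bij_betw (\<lambda>f. (restrict f ?U, restrict f (S - ?U)))
    {f \<in> S \<rightarrow>\<^sub>E T. image_mset (image f) A = B}
    ({f \<in> ?U \<rightarrow>\<^sub>E T. image_mset (image f) A = B} \<times> ((S - ?U) \<rightarrow>\<^sub>E T))"
  proof (rule bij_betw_byWitness[where f' = "\<lambda>(g, h). \<lambda>x. if x \<in> ?U then g x else h x"])
    show "\<forall>f\<in>{f \<in> S \<rightarrow>\<^sub>E T. image_mset (image f) A = B}.
        (case (restrict f ?U, restrict f (S - ?U)) of (g, h) \<Rightarrow> \<lambda>x. if x \<in> ?U then g x else h x) = f"
      by (auto simp: fun_eq_iff PiE_def extensional_def)
    show "\<forall>p\<in>{f \<in> ?U \<rightarrow>\<^sub>E T. image_mset (image f) A = B} \<times> ((S - ?U) \<rightarrow>\<^sub>E T).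
        (restrict (case p of (g, h) \<Rightarrow> \<lambda>x. if x \<in> ?U then g x else h x) ?U,
         restrict (case p of (g, h) \<Rightarrow> \<lambda>x. if x \<in> ?U then g x else h x) (S - ?U)) = p"
      by (auto simp: fun_eq_iff PiE_def extensional_def)
    show "(\<lambda>f. (restrict f ?U, restrict f (S - ?U))) ` {f \<in> S \<rightarrow>\<^sub>E T. image_mset (image f) A = B}
      \<subseteq> {f \<in> ?U \<rightarrow>\<^sub>E T. image_mset (image f) A = B} \<times> ((S - ?U) \<rightarrow>\<^sub>E T)"
    proof (intro image_subsetI SigmaI CollectI conjI)
      fix f assume f: "f \<in> {f \<in> S \<rightarrow>\<^sub>E T. image_mset (image f) A = B}"
      show "restrict f ?U \<in> ?U \<rightarrow>\<^sub>E T" "restrict f (S - ?U) \<in> S - ?U \<rightarrow>\<^sub>E T"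
        using f assms(2) by (auto simp: PiE_def Pi_def)
      have "image_mset (image (restrict f ?U)) A = image_mset (image f) A"
        by (rule image_mset_image_cong) simp
      then show "image_mset (image (restrict f ?U)) A = B" using f by simp
    qed
    show "(\<lambda>(g, h). \<lambda>x. if x \<in> ?U then g x else h x) `
        ({f \<in> ?U \<rightarrow>\<^sub>E T. image_mset (image f) A = B} \<times> ((S - ?U) \<rightarrow>\<^sub>E T))
      \<subseteq> {f \<in> S \<rightarrow>\<^sub>E T. image_mset (image f) A = B}"
    proof (intro image_subsetI CollectI conjI)
      fix p assume p: "p \<in> {f \<in> ?U \<rightarrow>\<^sub>E T. image_mset (image f) A = B} \<times> ((S - ?U) \<rightarrow>\<^sub>E T)"
      obtain g h where gh: "p = (g, h)" by force
      show "(case p of (g, h) \<Rightarrow> \<lambda>x. if x \<in> ?U then g x else h x) \<in> S \<rightarrow>\<^sub>E T"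
        using p assms(2) unfolding gh by (auto simp: PiE_def Pi_def extensional_def)
      have "image_mset (image (\<lambda>x. if x \<in> ?U then g x else h x)) A = image_mset (image g) A"
        by (rule image_mset_image_cong) simp
      then show "image_mset (image (case p of (g, h) \<Rightarrow> \<lambda>x. if x \<in> ?U then g x else h x)) A = B"
        using p gh by simp
    qed
  qed
  then have "card {f \<in> S \<rightarrow>\<^sub>E T. image_mset (image f) A = B} =
      card ({f \<in> ?U \<rightarrow>\<^sub>E T. image_mset (image f) A = B} \<times> ((S - ?U) \<rightarrow>\<^sub>E T))"
    by (rule bij_betw_same_card)
  also have "\<dots> = num_maps A B * card T ^ card (S - ?U)"
    using assms(1) by (simp add: card_cartesian_product maps_PiE[OF assms(3)] num_maps_def[symmetric] card_PiE)
  also have "card (S - ?U) = card S - card ?U"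
    using assms(1,2) by (intro card_Diff_subset) (auto intro: finite_subset)
  finally show ?thesis by simp
qed

lemma card_maps_eq:
  assumes "supp B \<subseteq> T"
  shows "card {f \<in> supp A \<rightarrow>\<^sub>E T. image_mset (image f) A = B} = num_maps A B"
  by (simp add: maps_PiE[OF assms] num_maps_def)

lemma quotient_mat_eq_iff:
  assumes "A \<in> sym_mats n" "f ` {..<n} \<subseteq> {..<k}" "M \<in> sym_mats k"
  shows "quotient_mat k f A = M \<longleftrightarrow> image_mset (image f) (edge_mset A) = edge_mset M"
  using edge_mset_inj[OF edge_quotient_mat(1)[OF assms(1,2)] assms(3)]
    edge_mset_quotient_mat[OF assms(1,2)] by auto

text \<open>Turns the weight of a map into a monomial, so that sums over maps can be grouped by the
  quotient they produce.\<close>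

lemma map_weight_quotient:
  assumes "A \<in> sym_mats v" "f ` {..<v} \<subseteq> {..<n}" "X \<in> sym_mats n"
  shows "map_weight A X f = mat_monomial (quotient_mat n f A) X"
  using map_weight_eq[OF assms(3), of f A] assms(2)
  by (simp add: mat_monomial_eq edge_mset_quotient_mat[OF assms(1,2)] sym_mats_dim[OF assms(1)]
      multiset.map_comp o_def)

lemma PiE_image: "f \<in> S \<rightarrow>\<^sub>E T \<Longrightarrow> f ` S \<subseteq> T"
  by auto

text \<open>The maps with quotient \<open>M\<close> are, up to relabelling, the surjections that
  exhibit \<open>H\<close> as a refinement of \<open>M\<close>. Here \<open>H\<close> is the finer
  graph, in contrast to the expectation formula.\<close>

lemma hom_poly_eq:
  assumes "is_graph H" "num_edges H \<le> d" "X \<in> sym_mats n"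
  shows "hom_poly H X =
    (\<Sum>C\<in>iso_classes_upto d. real (num_refinements H (rep C)) * sym_monomial (rep C) n X)"
proof -
  let ?R = "remove_isolated H" and ?v = "card (verts H)"
  note r = is_graph_remove_isolated[OF assms(1)]
  let ?F = "{..<?v} \<rightarrow>\<^sub>E {..<n}"
  have q: "quotient_mat n f ?R \<in> graphs_upto n d" if "f \<in> ?F" for f
    using edge_quotient_mat(1)[OF r(1) PiE_image[OF that]]
      edge_mset_quotient_mat[OF r(1) PiE_image[OF that]] mset_iso_size[OF r(2)] assms(2)
    by (simp add: graphs_upto_def num_edges_eq)
  have num: "card {f \<in> ?F. quotient_mat n f ?R = M} = num_refinements H (rep (iso_class M))"
    if M: "M \<in> sym_mats n" for M
  proof -
    have "{f \<in> ?F. quotient_mat n f ?R = M} =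
        {f \<in> ?F. image_mset (image f) (edge_mset ?R) = edge_mset M}"
      using quotient_mat_eq_iff[OF r(1) PiE_image M] by blast
    then have "card {f \<in> ?F. quotient_mat n f ?R = M} = num_maps (edge_mset ?R) (edge_mset M)"
      using card_maps_eq[of "edge_mset M" "{..<n}" "edge_mset ?R"] supp_edge_mset_subset[of M]
      by (simp only: r(3) sym_mats_dim[OF M])
    also have "\<dots> = num_refinements H (rep (iso_class M))"
      unfolding num_refinements_eq[OF assms(1) is_graphI[OF rep_iso_class(1)[OF is_graphI[OF M]]]]
      by (rule num_maps_iso[OF r(2) rep_iso_class(2)[OF is_graphI[OF M]]])
    finally show ?thesis .
  qed
  have "hom_poly H X = (\<Sum>f\<in>?F. mat_monomial (quotient_mat n f ?R) X)"
    unfolding hom_poly_def sym_mats_dim[OF assms(3)]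
    by (rule sum.cong[OF refl]) (rule map_weight_quotient[OF r(1) PiE_image assms(3)])
  also have "\<dots> = (\<Sum>M\<in>graphs_upto n d. \<Sum>f\<in>{f \<in> ?F. quotient_mat n f ?R = M}.
      mat_monomial (quotient_mat n f ?R) X)"
    by (rule sum.group[symmetric]) (use q in \<open>auto simp: finite_PiE\<close>)
  also have "\<dots> = (\<Sum>M\<in>graphs_upto n d. real (num_refinements H (rep (iso_class M))) * mat_monomial M X)"
    by (rule sum.cong) (auto simp: num[symmetric] graphs_upto_def)
  also have "\<dots> = (\<Sum>C\<in>iso_classes_upto d. real (num_refinements H (rep C)) * sym_monomial (rep C) n X)"
    by (rule sum_over_classes)
  finally show ?thesis .
qed

text \<open>Every member of the orbit is reached by the same number of injections, the number of
  automorphisms of \<open>H\<close>, which is \<open>num_refinements H H\<close>. The function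
  \<open>g\<close> is left arbitrary: monomials yield the injection polynomial, the constant 1 the
  size of the orbit.\<close>

lemma sum_injective_maps:
  fixes g :: "nat mat \<Rightarrow> 'a::comm_semiring_1"
  assumes "is_graph H"
  shows "(\<Sum>f\<in>{f \<in> {..<card (verts H)} \<rightarrow>\<^sub>E {..<n}. inj_on f {..<card (verts H)}}.
      g (quotient_mat n f (remove_isolated H))) =
    of_nat (num_refinements H H) * (\<Sum>M\<in>{M \<in> sym_mats n. mset_iso (edge_mset H) (edge_mset M)}. g M)"
proof -
  let ?R = "remove_isolated H" and ?v = "card (verts H)"
  note r = is_graph_remove_isolated[OF assms]
  let ?F = "{f \<in> {..<?v} \<rightarrow>\<^sub>E {..<n}. inj_on f {..<?v}}"
  let ?O = "{M \<in> sym_mats n. mset_iso (edge_mset H) (edge_mset M)}"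
  have fin: "finite ?O"
  proof (rule finite_subset)
    show "?O \<subseteq> graphs_upto n (num_edges H)"
      by (auto simp: graphs_upto_def num_edges_eq dest: mset_iso_size)
  qed simp
  have q: "quotient_mat n f ?R \<in> ?O" if "f \<in> ?F" for f
  proof -
    have f: "f ` {..<?v} \<subseteq> {..<n}" "inj_on f (supp (edge_mset ?R))" using that by (auto simp only: r(3))
    have "mset_iso (edge_mset ?R) (edge_mset (quotient_mat n f ?R))"
      by (rule mset_isoI[OF f(2) edge_mset_quotient_mat[OF r(1) f(1), symmetric]])
    then show ?thesis
      using edge_quotient_mat(1)[OF r(1) f(1)] mset_iso_iff[OF r(2)] by blast
  qed
  have num: "card {f \<in> ?F. quotient_mat n f ?R = M} = num_refinements H H" if M: "M \<in> ?O" for M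
  proof -
    have Ms: "M \<in> sym_mats n" and iso: "mset_iso (edge_mset H) (edge_mset M)" using M by auto
    \<comment> \<open>All maps onto \<open>M\<close> may be counted: \<open>M\<close> has as many
      vertices as \<open>H\<close>, so such a map is injective by cardinality.\<close>
    have "inj_on f {..<?v}" if "image_mset (image f) (edge_mset ?R) = edge_mset M" for f
    proof (rule eq_card_imp_inj_on)
      have "f ` {..<?v} = supp (edge_mset M)"
        using supp_image[of f "edge_mset ?R"] that by (simp only: r(3))
      then show "card (f ` {..<?v}) = card {..<?v}"
        using mset_iso_card[OF iso] by (simp add: verts_graph[OF assms])
    qed simp
    then have "{f \<in> ?F. quotient_mat n f ?R = M} =
        {f \<in> {..<?v} \<rightarrow>\<^sub>E {..<n}. image_mset (image f) (edge_mset ?R) = edge_mset M}"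
      using quotient_mat_eq_iff[OF r(1) PiE_image Ms] by blast
    then have "card {f \<in> ?F. quotient_mat n f ?R = M} = num_maps (edge_mset ?R) (edge_mset M)"
      using card_maps_eq[of "edge_mset M" "{..<n}" "edge_mset ?R"] supp_edge_mset_subset[of M]
      by (simp only: r(3) sym_mats_dim[OF Ms])
    also have "\<dots> = num_refinements H H"
      unfolding num_refinements_eq[OF assms assms]
      by (rule num_maps_iso[OF r(2) mset_iso_sym[OF iso]])
    finally show ?thesis .
  qed
  have "(\<Sum>f\<in>?F. g (quotient_mat n f ?R)) =
      (\<Sum>M\<in>?O. \<Sum>f\<in>{f \<in> ?F. quotient_mat n f ?R = M}. g (quotient_mat n f ?R))"
    by (rule sum.group[symmetric]) (use q fin in \<open>auto simp: finite_PiE\<close>)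
  also have "\<dots> = (\<Sum>M\<in>?O. of_nat (num_refinements H H) * g M)"
    by (rule sum.cong) (auto simp: num[symmetric])
  finally show ?thesis by (simp add: sum_distrib_left)
qed

lemma inj_poly_eq:
  assumes "is_graph H" "X \<in> sym_mats n"
  shows "inj_poly H X = real (num_refinements H H) * sym_monomial H n X"
proof -
  note r = is_graph_remove_isolated[OF assms(1)]
  have "inj_poly H X = (\<Sum>f\<in>{f \<in> {..<card (verts H)} \<rightarrow>\<^sub>E {..<n}. inj_on f {..<card (verts H)}}.
      mat_monomial (quotient_mat n f (remove_isolated H)) X)"
    unfolding inj_poly_def sym_mats_dim[OF assms(2)]
    by (rule sum.cong[OF refl]) (use map_weight_quotient[OF r(1) PiE_image assms(2)] in blast)
  then show ?thesis
    by (simp only: sum_injective_maps[OF assms(1), of "\<lambda>M. mat_monomial M X"] sym_monomial_eq[OF assms(1)])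
qed

section \<open>Orbit sizes and the multinomial expansion\<close>

text \<open>The product is the shape in which the number of injections is obtained; multiplying by
  the complementary factorial avoids division of natural numbers.\<close>

lemma falling_factorial_eq:
  "v \<le> k \<Longrightarrow> prod ((-) k) {0..<v} * fact (k - v) = (fact k :: nat)"
proof (induction v)
  case (Suc v)
  have "prod ((-) k) {0..<Suc v} * fact (k - Suc v) = prod ((-) k) {0..<v} * ((k - v) * fact (k - v - 1))"
    by simp
  also have "(k - v) * fact (k - v - 1) = fact (k - v)"
    using Suc.prems fact_reduce[of "k - v", where 'a = nat] by simp
  finally show ?case using Suc by simp
qed simp

text \<open>The orbit-stabilizer relation: automorphisms times orbit size equals the number of
  injections of the vertices into \<open>k\<close> points.\<close>

lemma card_orbit:
  assumes "is_graph H" "card (verts H) \<le> k"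
  shows "real (num_refinements H H) * real (card {M \<in> sym_mats k. mset_iso (edge_mset H) (edge_mset M)}) =
    fact k / fact (k - card (verts H))"
proof -
  let ?v = "card (verts H)"
  have "num_refinements H H * card {M \<in> sym_mats k. mset_iso (edge_mset H) (edge_mset M)} =
      card {f \<in> {..<?v} \<rightarrow>\<^sub>E {..<k}. inj_on f {..<?v}}"
    using sum_injective_maps[OF assms(1), of "\<lambda>_. 1::nat" k] by simp
  also have "\<dots> = prod ((-) k) {0..<?v}"
    using card_inj_on_subset_funcset[of "{..<?v}" "{..<k}" "{..<?v}"] by simp
  finally have "num_refinements H H * card {M \<in> sym_mats k. mset_iso (edge_mset H) (edge_mset M)}
      * fact (k - ?v) = fact k"
    using falling_factorial_eq[OF assms(2)] by simp
  then have "real (num_refinements H H * card {M \<in> sym_mats k. mset_iso (edge_mset H) (edge_mset M)}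
      * fact (k - ?v)) = fact k"
    by (simp only: of_nat_fact)
  then show ?thesis by (simp add: field_simps)
qed

lemma mset_fact_add: "mset_fact (add_mset e A) = mset_fact A * Suc (count A e)"
proof -
  let ?S = "insert e (set_mset A)"
  have "mset_fact (add_mset e A) = (\<Prod>x\<in>?S. fact (count (add_mset e A) x))"
    by (simp add: mset_fact_def)
  also have "\<dots> = fact (count (add_mset e A) e) * (\<Prod>x\<in>?S - {e}. fact (count (add_mset e A) x))"
    by (rule prod.remove) auto
  also have "(\<Prod>x\<in>?S - {e}. fact (count (add_mset e A) x)) = (\<Prod>x\<in>?S - {e}. fact (count A x))"
    by (rule prod.cong) auto
  also have "fact (count (add_mset e A) e) * \<dots> = Suc (count A e) * (fact (count A e) * (\<Prod>x\<in>?S - {e}. fact (count A x)))"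
    by (simp add: algebra_simps)
  also have "fact (count A e) * (\<Prod>x\<in>?S - {e}. fact (count A x)) = (\<Prod>x\<in>?S. fact (count A x))"
    by (subst prod.remove[of ?S e]) auto
  also have "\<dots> = mset_fact A"
    by (rule mset_fact_superset[symmetric]) auto
  finally show ?thesis by simp
qed

lemma finite_msets_image:
  "finite S \<Longrightarrow> finite {A. set_mset A \<subseteq> S \<and> image_mset g A = B}"
proof (rule finite_subset)
  show "{A. set_mset A \<subseteq> S \<and> image_mset g A = B} \<subseteq> mset ` {xs. set xs \<subseteq> S \<and> length xs = size B}"
  proof
    fix A assume A: "A \<in> {A. set_mset A \<subseteq> S \<and> image_mset g A = B}"
    obtain xs where "A = mset xs" by (metis ex_mset)
    then show "A \<in> mset ` {xs. set xs \<subseteq> S \<and> length xs = size B}" using A by auto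
  qed
qed (simp add: finite_lists_length_eq)

text \<open>The multinomial theorem in fibre form. Expanding the product chooses a preimage for each
  element of \<open>B\<close>, counted with multiplicity, and the ratio of factorials is the number
  of choices that produce the multiset \<open>A\<close>.\<close>

lemma multinomial_expansion:
  fixes x :: "'a \<Rightarrow> real"
  assumes "finite S"
  shows "(\<Prod>E\<in>#B. \<Sum>e\<in>{e \<in> S. g e = E}. x e) =
    (\<Sum>A\<in>{A. set_mset A \<subseteq> S \<and> image_mset g A = B}.
      real (mset_fact B) / real (mset_fact A) * (\<Prod>e\<in>#A. x e))"
proof (induction B)
  case empty
  have "{A. set_mset A \<subseteq> S \<and> image_mset g A = {#}} = {{#}}" by auto
  then show ?case by (simp add: mset_fact_def)
next
  case (add E B)
  define T where "T B = {A. set_mset A \<subseteq> S \<and> image_mset g A = B}" for B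
  define S' where "S' = {e \<in> S. g e = E}"
  have fin: "finite (T B)" "finite S'" for B
    using finite_msets_image[OF assms] assms by (auto simp: T_def S'_def)
  define P where "P = S' \<times> T B"
  \<comment> \<open>\<open>A'\<close> arises by adding some \<open>e\<close> over \<open>E\<close>
    to \<open>A' - {#e#}\<close>. The reciprocal factorial of the latter is that of
    \<open>A'\<close> times the multiplicity of \<open>e\<close>; these multiplicities add up to
    that of \<open>E\<close> in \<open>add_mset E B\<close>, which is the factor by which the
    factorial of \<open>B\<close> grows.\<close>
  have inner: "(\<Sum>(e, A)\<in>{(e, A) \<in> P. add_mset e A = A'}. real (mset_fact B) / real (mset_fact A)) =
      real (mset_fact (add_mset E B)) / real (mset_fact A')" if A': "A' \<in> T (add_mset E B)" for A'
  proof -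
    have bij: "{(e, A) \<in> P. add_mset e A = A'} = (\<lambda>e. (e, A' - {#e#})) ` (g -` {E} \<inter> set_mset A')"
      using A' by (auto simp: P_def T_def S'_def image_mset_Diff dest!: multi_member_split)
    have "(\<Sum>(e, A)\<in>{(e, A) \<in> P. add_mset e A = A'}. real (mset_fact B) / real (mset_fact A)) =
        (\<Sum>e\<in>g -` {E} \<inter> set_mset A'. real (mset_fact B) / real (mset_fact (A' - {#e#})))"
      unfolding bij by (subst sum.reindex) (auto simp: inj_on_def)
    also have "\<dots> = (\<Sum>e\<in>g -` {E} \<inter> set_mset A'. real (mset_fact B) / real (mset_fact A') * real (count A' e))"
    proof (rule sum.cong)
      fix e assume "e \<in> g -` {E} \<inter> set_mset A'"
      then obtain A where "A' = add_mset e A" by (auto dest: multi_member_split)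
      then show "real (mset_fact B) / real (mset_fact (A' - {#e#})) =
          real (mset_fact B) / real (mset_fact A') * real (count A' e)"
        by (simp add: mset_fact_add del: of_nat_Suc mult_Suc_right)
    qed simp
    also have "\<dots> = real (mset_fact B) / real (mset_fact A') * real (count (image_mset g A') E)"
      by (simp add: count_image_mset sum_distrib_left)
    also have "image_mset g A' = add_mset E B" using A' by (simp add: T_def)
    finally show ?thesis by (simp add: mset_fact_add field_simps)
  qed
  have "(\<Prod>E\<in>#add_mset E B. \<Sum>e\<in>{e \<in> S. g e = E}. x e) =
      (\<Sum>e\<in>S'. x e) * (\<Sum>A\<in>T B. real (mset_fact B) / real (mset_fact A) * (\<Prod>e\<in>#A. x e))"
    using add by (simp add: T_def S'_def)
  also have "\<dots> = (\<Sum>(e, A)\<in>P. real (mset_fact B) / real (mset_fact A) * (\<Prod>e\<in>#add_mset e A. x e))"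
    unfolding P_def sum_product sum.cartesian_product by (rule sum.cong) (auto simp: algebra_simps)
  also have "\<dots> = (\<Sum>A'\<in>T (add_mset E B). \<Sum>p\<in>{p \<in> P. (\<lambda>(e, A). add_mset e A) p = A'}.
      (\<lambda>(e, A). real (mset_fact B) / real (mset_fact A) * (\<Prod>e\<in>#add_mset e A. x e)) p)"
    by (rule sum.group[symmetric]) (use fin in \<open>auto simp: P_def T_def S'_def\<close>)
  also have "\<dots> = (\<Sum>A'\<in>T (add_mset E B).
      (\<Sum>(e, A)\<in>{(e, A) \<in> P. add_mset e A = A'}. real (mset_fact B) / real (mset_fact A)) * (\<Prod>e\<in>#A'. x e))"
  proof (rule sum.cong[OF refl])
    fix A'
    have eq: "{p \<in> P. (\<lambda>(e, A). add_mset e A) p = A'} = {(e, A) \<in> P. add_mset e A = A'}" by auto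
    show "(\<Sum>p\<in>{p \<in> P. (\<lambda>(e, A). add_mset e A) p = A'}.
        (\<lambda>(e, A). real (mset_fact B) / real (mset_fact A) * (\<Prod>e\<in>#add_mset e A. x e)) p) =
      (\<Sum>(e, A)\<in>{(e, A) \<in> P. add_mset e A = A'}. real (mset_fact B) / real (mset_fact A)) * (\<Prod>e\<in>#A'. x e)"
      unfolding eq sum_distrib_right by (rule sum.cong) auto
  qed
  also have "\<dots> = (\<Sum>A'\<in>T (add_mset E B). real (mset_fact (add_mset E B)) / real (mset_fact A') * (\<Prod>e\<in>#A'. x e))"
    by (rule sum.cong) (simp_all only: inner)
  finally show ?case by (simp only: T_def)
qed

text \<open>Each entry of the quotient is a sum over the edges sent to it, so the multinomial
  expansion applies with \<open>g\<close> the action of \<open>f\<close> on edges.\<close>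

lemma mat_monomial_quotient:
  assumes "X \<in> sym_mats n" "f ` {..<n} \<subseteq> {..<k}" "G \<in> sym_mats k" "num_edges G \<le> d"
  shows "mat_monomial G (quotient_mat k f X) =
    (\<Sum>M\<in>{M \<in> graphs_upto n d. image_mset (image f) (edge_mset M) = edge_mset G}.
      real (graph_fact G) / real (graph_fact M) * mat_monomial M X)"
proof -
  let ?T = "{M \<in> graphs_upto n d. image_mset (image f) (edge_mset M) = edge_mset G}"
  have "mat_monomial G (quotient_mat k f X) =
      (\<Prod>E\<in>#edge_mset G. \<Sum>e\<in>{e \<in> edges_on n. f ` e = E}. edge X e)"
    unfolding mat_monomial_eq
    by (intro arg_cong[where f = prod_mset] image_mset_cong edge_quotient_mat(2)[OF assms(1,2)])
      (use set_edge_mset[of G] in \<open>auto simp: sym_mats_dim[OF assms(3)]\<close>)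
  also have "\<dots> = (\<Sum>A\<in>{A. set_mset A \<subseteq> edges_on n \<and> image_mset (image f) A = edge_mset G}.
      real (mset_fact (edge_mset G)) / real (mset_fact A) * (\<Prod>e\<in>#A. edge X e))"
    by (rule multinomial_expansion) simp
  also have "{A. set_mset A \<subseteq> edges_on n \<and> image_mset (image f) A = edge_mset G} = edge_mset ` ?T"
  proof (intro equalityI subsetI)
    fix A assume A: "A \<in> {A. set_mset A \<subseteq> edges_on n \<and> image_mset (image f) A = edge_mset G}"
    then have e: "edge_mset (graph_of n A) = A" by (intro edge_mset_graph_of) auto
    have "size (image_mset (image f) A) = size (edge_mset G)" using A by simp
    then have "size A = size (edge_mset G)" by simp
    then have "graph_of n A \<in> ?T"
      using e A graph_of_sym assms(4) by (auto simp: graphs_upto_def num_edges_eq)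
    then show "A \<in> edge_mset ` ?T" by (rule image_eqI[of A edge_mset "graph_of n A", OF e[symmetric]])
  next
    fix A assume "A \<in> edge_mset ` ?T"
    then obtain M where M: "M \<in> ?T" "A = edge_mset M" by blast
    then show "A \<in> {A. set_mset A \<subseteq> edges_on n \<and> image_mset (image f) A = edge_mset G}"
      using set_edge_mset[of M] by (auto simp: graphs_upto_def sym_mats_dim)
  qed
  also have "(\<Sum>A\<in>edge_mset ` ?T. real (mset_fact (edge_mset G)) / real (mset_fact A) * (\<Prod>e\<in>#A. edge X e)) =
      (\<Sum>M\<in>?T. real (graph_fact G) / real (graph_fact M) * mat_monomial M X)"
  proof -
    have "inj_on edge_mset ?T"
      by (rule inj_onI) (auto simp: graphs_upto_def intro: edge_mset_inj)
    then show ?thesis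
      by (simp add: sum.reindex graph_fact_eq mat_monomial_eq)
  qed
  finally show ?thesis .
qed

lemma finite_refinement_maps: "finite (refinement_maps G H)"
  unfolding refinement_maps_def
  by (rule finite_subset[of _ "{..<card (verts G)} \<rightarrow>\<^sub>E {..<card (verts H)}"]) (auto simp: finite_PiE)

lemma num_refinements_self: "is_graph H \<Longrightarrow> num_refinements H H \<noteq> 0"
proof -
  assume H: "is_graph H"
  have "restrict id (supp (edge_mset (remove_isolated H))) \<in> refinement_maps H H"
    unfolding refinement_maps_eq[OF H H]
    using image_mset_image_id[of "edge_mset (remove_isolated H)" "restrict id (supp (edge_mset (remove_isolated H)))"]
    by simp
  then show ?thesis
    unfolding num_refinements_def using card_0_eq[OF finite_refinement_maps[of H H]] by blast
qed

text \<open>The sum runs over all classes with at most \<open>d\<close> edges, those that do not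
  refine \<open>H\<close> having coefficient zero. A range that does not depend on \<open>H\<close>
  is what the triangular change of basis requires.\<close>

lemma expected_poly_eq:
  assumes "is_graph H" "num_edges H \<le> d" "X \<in> sym_mats n" "1 \<le> k" "card (verts H) \<le> k"
  shows "expected_poly k H n X = (\<Sum>C\<in>iso_classes_upto d.
    real (graph_fact H) / real (graph_fact (rep C))
      * ((fact k / fact (k - card (verts H))) / real k ^ card (verts (rep C)))
      * (real (num_refinements (rep C) H) / real (num_refinements H H))
      * sym_monomial (rep C) n X)"
proof -
  let ?F = "{..<n} \<rightarrow>\<^sub>E {..<k}"
  let ?O = "{G \<in> sym_mats k. mset_iso (edge_mset H) (edge_mset G)}"
  define c where "c G = real (graph_fact H) / real (graph_fact G)
      * ((fact k / fact (k - card (verts H))) / real k ^ card (verts G))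
      * (real (num_refinements G H) / real (num_refinements H H))" for G
  have ne: "?F \<noteq> {}" "finite ?F"
    using assms(4) by (auto simp: PiE_eq_empty_iff finite_PiE lessThan_empty_iff)
  have fO: "finite ?O"
  proof (rule finite_subset)
    show "?O \<subseteq> graphs_upto k (num_edges H)"
      by (auto simp: graphs_upto_def num_edges_eq dest: mset_iso_size)
  qed simp
  have "expected_poly k H n X = (\<Sum>f\<in>?F. sym_monomial H k (quotient_mat k f X)) / real k ^ n"
    unfolding expected_poly_def random_quotient_def
    using ne by (simp add: integral_pmf_of_set card_PiE)
  also have "(\<Sum>f\<in>?F. sym_monomial H k (quotient_mat k f X)) =
      (\<Sum>f\<in>?F. \<Sum>G\<in>?O. \<Sum>M\<in>{M \<in> graphs_upto n d. image_mset (image f) (edge_mset M) = edge_mset G}.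
        real (graph_fact H) / real (graph_fact M) * mat_monomial M X)"
    unfolding sym_monomial_eq[OF assms(1)]
  proof (intro sum.cong refl)
    fix f G assume f: "f \<in> ?F" and G: "G \<in> ?O"
    have "graph_fact G = graph_fact H" "num_edges G \<le> d"
      using mset_iso_fact[of "edge_mset H" "edge_mset G"] mset_iso_size[of "edge_mset H" "edge_mset G"]
        G assms(2) by (simp_all add: graph_fact_eq num_edges_eq)
    then show "mat_monomial G (quotient_mat k f X) =
      (\<Sum>M\<in>{M \<in> graphs_upto n d. image_mset (image f) (edge_mset M) = edge_mset G}.
        real (graph_fact H) / real (graph_fact M) * mat_monomial M X)"
      using mat_monomial_quotient[OF assms(3) PiE_image[OF f], of G d] G by simp
  qed
  \<comment> \<open>The condition linking \<open>M\<close>, \<open>f\<close> and \<open>G\<close>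
    becomes an indicator, so that the three ranges are independent and the sums can be
    interchanged.\<close>
  also have "\<dots> = (\<Sum>f\<in>?F. \<Sum>G\<in>?O. \<Sum>M\<in>graphs_upto n d.
      if image_mset (image f) (edge_mset M) = edge_mset G
      then real (graph_fact H) / real (graph_fact M) * mat_monomial M X else 0)"
    by (rule sum.cong[OF refl], rule sum.cong[OF refl], rule sum.mono_neutral_cong_left) auto
  also have "\<dots> = (\<Sum>f\<in>?F. \<Sum>M\<in>graphs_upto n d. \<Sum>G\<in>?O.
      if image_mset (image f) (edge_mset M) = edge_mset G
      then real (graph_fact H) / real (graph_fact M) * mat_monomial M X else 0)"
    by (rule sum.cong[OF refl], rule sum.swap)
  also have "\<dots> = (\<Sum>M\<in>graphs_upto n d. \<Sum>f\<in>?F. \<Sum>G\<in>?O.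
      if image_mset (image f) (edge_mset M) = edge_mset G
      then real (graph_fact H) / real (graph_fact M) * mat_monomial M X else 0)"
    by (rule sum.swap)
  also have "\<dots> = (\<Sum>M\<in>graphs_upto n d. \<Sum>G\<in>?O. \<Sum>f\<in>?F.
      if image_mset (image f) (edge_mset M) = edge_mset G
      then real (graph_fact H) / real (graph_fact M) * mat_monomial M X else 0)"
    by (rule sum.cong[OF refl], rule sum.swap)
  also have "\<dots> = (\<Sum>M\<in>graphs_upto n d. \<Sum>G\<in>?O.
      real (card {f \<in> ?F. image_mset (image f) (edge_mset M) = edge_mset G}) *
      (real (graph_fact H) / real (graph_fact M) * mat_monomial M X))"
    by (intro sum.cong refl) (simp add: sum.inter_filter[OF ne(2), symmetric])
  \<comment> \<open>For a fixed exponent \<open>M\<close> the number of maps is the same for every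
    \<open>G\<close> in the orbit, so the sum over \<open>G\<close> is a product with the orbit
    size.\<close>
  also have "\<dots> / real k ^ n = (\<Sum>M\<in>graphs_upto n d. c (rep (iso_class M)) * mat_monomial M X)"
  proof (subst sum_divide_distrib, rule sum.cong[OF refl])
    fix M assume M: "M \<in> graphs_upto n d"
    then have Ms: "M \<in> sym_mats n" and gM: "is_graph M" by (auto simp: graphs_upto_def intro: is_graphI)
    let ?M = "rep (iso_class M)" and ?w = "card (verts M)"
    note i = rep_iso_class[OF gM]
    have gr: "is_graph ?M" using i(1) by (rule is_graphI)
    have sup: "supp (edge_mset M) \<subseteq> {..<n}"
      using supp_edge_mset_subset[of M] by (simp add: sym_mats_dim[OF Ms])
    have w: "?w \<le> n" using card_mono[OF _ sup] by (simp add: verts_graph[OF gM])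
    have num: "card {f \<in> ?F. image_mset (image f) (edge_mset M) = edge_mset G} =
        k ^ (n - ?w) * num_refinements M H" if "G \<in> ?O" for G
    proof -
      have "supp (edge_mset G) \<subseteq> {..<k}"
        using that supp_edge_mset_subset[of G] by (auto simp: sym_mats_dim)
      from card_maps_superset[OF _ sup this] have
        "card {f \<in> ?F. image_mset (image f) (edge_mset M) = edge_mset G} =
          k ^ (n - ?w) * num_maps (edge_mset M) (edge_mset G)"
        by (simp add: verts_graph[OF gM])
      then show ?thesis
        using that num_maps_iso[OF mset_iso_refl, of "edge_mset H" "edge_mset G" "edge_mset M"]
        by (simp add: num_refinements_eq[OF gM assms(1)])
    qed
    have "c ?M = c M"
      using mset_iso_fact[OF i(2)] mset_iso_card[OF i(2)] num_maps_iso[OF i(2) mset_iso_refl[of "edge_mset H"]]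
      by (simp add: c_def graph_fact_eq verts_graph gM gr num_refinements_eq assms(1))
    have cO: "real (card ?O) = (fact k / fact (k - card (verts H))) / real (num_refinements H H)"
      using card_orbit[OF assms(1,5)] num_refinements_self[OF assms(1)] by (simp add: field_simps)
    have kn: "real k ^ n = real k ^ (n - ?w) * real k ^ ?w"
      using w by (simp add: power_add[symmetric])
    have "(\<Sum>G\<in>?O. real (card {f \<in> ?F. image_mset (image f) (edge_mset M) = edge_mset G}) *
        (real (graph_fact H) / real (graph_fact M) * mat_monomial M X)) / real k ^ n =
      (real (card ?O) * real (k ^ (n - ?w) * num_refinements M H)) *
        (real (graph_fact H) / real (graph_fact M) * mat_monomial M X) / real k ^ n"
      by (simp add: num)
    also have "\<dots> = c M * mat_monomial M X"
      unfolding cO kn using assms(4) by (simp add: c_def ac_simps)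
    finally show "(\<Sum>G\<in>?O. real (card {f \<in> ?F. image_mset (image f) (edge_mset M) = edge_mset G}) *
        (real (graph_fact H) / real (graph_fact M) * mat_monomial M X)) / real k ^ n =
        c ?M * mat_monomial M X"
      using \<open>c ?M = c M\<close> by simp
  qed
  also have "\<dots> = (\<Sum>C\<in>iso_classes_upto d. c (rep C) * sym_monomial (rep C) n X)"
    by (rule sum_over_classes)
  finally show ?thesis by (simp only: c_def)
qed

text \<open>A quotient moves edges without losing any. This confines the refinements of
  \<open>H\<close> to the finite set of classes over which the expansion runs.\<close>

lemma is_refinement_num_edges:
  assumes "is_graph G" "is_graph H" "is_refinement G H"
  shows "num_edges G = num_edges H"
proof -
  obtain f where "image_mset (image f) (edge_mset (remove_isolated G)) = edge_mset (remove_isolated H)"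
    using assms(3) by (auto simp: is_refinement_def refinement_maps_eq[OF assms(1,2)])
  from arg_cong[OF this, of size] show ?thesis
    using mset_iso_size[OF is_graph_remove_isolated(2)[OF assms(1)]]
      mset_iso_size[OF is_graph_remove_isolated(2)[OF assms(2)]] by (simp add: num_edges_eq)
qed

lemma expected_poly_refinements:
  assumes "is_graph H" "X \<in> sym_mats n" "1 \<le> k" "card (verts H) \<le> k"
  shows "expected_poly k H n X = (\<Sum>C\<in>{C \<in> iso_classes. is_refinement (rep C) H}.
    real (graph_fact H) / real (graph_fact (rep C))
      * ((fact k / fact (k - card (verts H))) / real k ^ card (verts (rep C)))
      * (real (num_refinements (rep C) H) / real (num_refinements H H))
      * sym_monomial (rep C) n X)"
  unfolding expected_poly_eq[OF assms(1) order_refl assms(2-4)]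
proof (rule sum.mono_neutral_right)
  show "{C \<in> iso_classes. is_refinement (rep C) H} \<subseteq> iso_classes_upto (num_edges H)"
  proof
    fix C assume C: "C \<in> {C \<in> iso_classes. is_refinement (rep C) H}"
    then have "is_graph (rep C)" "iso_class (rep C) = C" using iso_class_rep[of C] by simp_all
    moreover from this have "num_edges (rep C) = num_edges H"
      using C is_refinement_num_edges assms(1) by blast
    ultimately show "C \<in> iso_classes_upto (num_edges H)"
      unfolding iso_classes_upto_def by (auto intro!: exI[of _ "rep C"])
  qed
  show "\<forall>C\<in>iso_classes_upto (num_edges H) - {C \<in> iso_classes. is_refinement (rep C) H}.
    real (graph_fact H) / real (graph_fact (rep C))
      * ((fact k / fact (k - card (verts H))) / real k ^ card (verts (rep C)))
      * (real (num_refinements (rep C) H) / real (num_refinements H H))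
      * sym_monomial (rep C) n X = 0" (is "\<forall>C\<in>_. ?g C = 0")
  proof
    fix C assume C: "C \<in> iso_classes_upto (num_edges H) - {C \<in> iso_classes. is_refinement (rep C) H}"
    then have "C \<in> iso_classes" using iso_classes_upto_rep(1)[of C] by blast
    then have "num_refinements (rep C) H = 0"
      using C by (simp add: is_refinement_def num_refinements_def)
    then show "?g C = 0" by simp
  qed
qed simp

section \<open>Bases of the freely-described polynomials\<close>

text \<open>Kronecker substitution: coordinate \<open>a\<close> is the last digit in a base
  \<open>B\<close>, and the weights of the other coordinates are scaled by \<open>B\<close>, so that
  reduction modulo \<open>B\<close> recovers the digit.\<close>

lemma separating_weight:
  fixes S :: "('a \<Rightarrow> nat) set"
  assumes "finite I" "finite S"
  shows "\<exists>w. \<forall>e\<in>S. \<forall>e'\<in>S. (\<Sum>i\<in>I. w i * e i) = (\<Sum>i\<in>I. w i * e' i) \<longrightarrow> (\<forall>i\<in>I. e i = e' i)"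
  using assms(1)
proof (induction I rule: finite_induct)
  case (insert a I)
  then obtain w where w: "\<And>e e'. e \<in> S \<Longrightarrow> e' \<in> S \<Longrightarrow>
      (\<Sum>i\<in>I. w i * e i) = (\<Sum>i\<in>I. w i * e' i) \<Longrightarrow> \<forall>i\<in>I. e i = e' i" by blast
  \<comment> \<open>One more than the largest value at \<open>a\<close>, so that all these values
    are digits in base \<open>B\<close>.\<close>
  define B where "B = Suc (Max ((\<lambda>e. e a) ` S))"
  have B: "e a < B" if "e \<in> S" for e
    unfolding B_def using that assms(2) by (intro le_imp_less_Suc Max_ge) auto
  define w' where "w' i = (if i = a then 1 else B * w i)" for i
  have sum: "(\<Sum>i\<in>insert a I. w' i * e i) = e a + B * (\<Sum>i\<in>I. w i * e i)" for e
  proof -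
    have "(\<Sum>i\<in>I. w' i * e i) = (\<Sum>i\<in>I. B * (w i * e i))"
      by (rule sum.cong) (use insert.hyps in \<open>auto simp: w'_def\<close>)
    then show ?thesis using insert.hyps by (simp add: w'_def sum_distrib_left)
  qed
  show ?case
  proof (intro exI[of _ w'] ballI impI)
    fix e e' i
    assume e: "e \<in> S" "e' \<in> S" and i: "i \<in> insert a I"
      and "(\<Sum>i\<in>insert a I. w' i * e i) = (\<Sum>i\<in>insert a I. w' i * e' i)"
    then have eq: "e a + B * (\<Sum>i\<in>I. w i * e i) = e' a + B * (\<Sum>i\<in>I. w i * e' i)"
      by (simp only: sum)
    from arg_cong[OF this, of "\<lambda>x. x mod B"] have "e a = e' a"
      using B[OF e(1)] B[OF e(2)] by simp
    moreover from this eq have "(\<Sum>i\<in>I. w i * e i) = (\<Sum>i\<in>I. w i * e' i)"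
      using B[OF e(1)] by simp
    ultimately show "e i = e' i" using w[OF e] i by blast
  qed
qed simp

text \<open>Substituting powers of one variable with separating exponents reduces the claim to a
  univariate polynomial.\<close>

lemma monomials_independent:
  assumes "finite T" "T \<subseteq> sym_mats n"
    and zero: "\<And>X. X \<in> sym_mats n \<Longrightarrow> (\<Sum>G\<in>T. c G * mat_monomial G X) = 0"
    and "G \<in> T"
  shows "c G = 0"
proof -
  obtain w where w: "\<forall>e\<in>(\<lambda>G. count (edge_mset G)) ` T. \<forall>e'\<in>(\<lambda>G. count (edge_mset G)) ` T.
      (\<Sum>i\<in>edges_on n. w i * e i) = (\<Sum>i\<in>edges_on n. w i * e' i) \<longrightarrow> (\<forall>i\<in>edges_on n. e i = e' i)"
    using separating_weight[OF finite_edges_on finite_imageI[OF assms(1)]] by (rule exE)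
  define N where "N G = (\<Sum>e\<in>edges_on n. w e * count (edge_mset G) e)" for G
  have sub: "set_mset (edge_mset G) \<subseteq> edges_on n" if "G \<in> T" for G
    using set_edge_mset[of G] that assms(2) sym_mats_dim(1)[of G n] by auto
  have inj: "inj_on N T"
  proof (rule inj_onI)
    fix G G' assume G: "G \<in> T" "G' \<in> T" "N G = N G'"
    then have eq: "\<forall>e\<in>edges_on n. count (edge_mset G) e = count (edge_mset G') e"
      using bspec[OF bspec[OF w imageI[OF G(1)]] imageI[OF G(2)]] unfolding N_def by blast
    have "edge_mset G = edge_mset G'"
    proof (rule multiset_eqI)
      fix e
      show "count (edge_mset G) e = count (edge_mset G') e"
      proof (cases "e \<in> edges_on n")
        case False
        then have "e \<notin># edge_mset G" "e \<notin># edge_mset G'" using sub[OF G(1)] sub[OF G(2)] by auto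
        then show ?thesis by (simp add: not_in_iff)
      qed (use eq in blast)
    qed
    then show "G = G'" using G(1,2) assms(2) by (intro edge_mset_inj[of G n G']) auto
  qed
  \<comment> \<open>Injectivity of \<open>N\<close> keeps the terms apart: the coefficient of
    \<open>p\<close> at \<open>N G\<close> is \<open>c G\<close> alone.\<close>
  define p where "p = (\<Sum>G\<in>T. Polynomial.monom (c G) (N G))"
  have "poly p t = 0" for t
  proof -
    define X where "X = Matrix.mat n n (\<lambda>(i, j). t ^ w {i, j})"
    have X: "X \<in> sym_mats n" unfolding X_def by (rule sym_matsI) (simp add: insert_commute)
    have eX: "edge X e = t ^ w e" if e: "e \<in> edges_on n" for e
    proof -
      obtain i j where "i < n" "j < n" "e = {i, j}" using e by (auto simp: edges_on_iff)
      then show ?thesis using edge_doubleton[OF X, of i j] by (simp add: X_def)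
    qed
    have "mat_monomial G X = t ^ N G" if "G \<in> T" for G
      unfolding mat_monomial_eq prod_mset_superset[OF finite_edges_on sub[OF that]] N_def power_sum
      by (rule prod.cong) (auto simp: eX power_mult)
    then have "poly p t = (\<Sum>G\<in>T. c G * mat_monomial G X)"
      by (simp add: p_def poly_sum poly_monom)
    then show ?thesis using zero[OF X] by simp
  qed
  then have "p = 0" using poly_all_0_iff_0[of p] by blast
  then have "0 = coeff p (N G)" by simp
  also have "\<dots> = (\<Sum>G'\<in>T. if G' = G then c G' else 0)"
    unfolding p_def coeff_sum using inj assms(4) by (intro sum.cong) (auto simp: inj_on_def)
  also have "\<dots> = c G" using assms(1,4) by simp
  finally show ?thesis by simp
qed

lemma monomials_coeff_unique:
  assumes "\<And>X. X \<in> sym_mats n \<Longrightarrow>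
      (\<Sum>M\<in>graphs_upto n d. c M * mat_monomial M X) = (\<Sum>M\<in>graphs_upto n d. c' M * mat_monomial M X)"
    and "G \<in> graphs_upto n d"
  shows "c G = c' G"
proof -
  have "c G - c' G = 0"
    by (rule monomials_independent[OF finite_graphs_upto _ _ assms(2), of n "\<lambda>G. c G - c' G"])
      (use assms(1) in \<open>auto simp: graphs_upto_def left_diff_distrib sum_subtractf\<close>)
  then show ?thesis by simp
qed

section \<open>Permutations and zero-padding acting on coefficients\<close>

text \<open>The quotient by a permutation is a relabelling that pushes edges forward, whereas
  \<open>permute_mat\<close> pulls entries back. Acting on exponents by the former and on points by
  the latter gives adjoint actions on monomials.\<close>

lemma quotient_permutation:
  assumes "M \<in> sym_mats n" "\<tau> permutes {..<n}"
  shows "quotient_mat n \<tau> M \<in> sym_mats n"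
    and "edge_mset (quotient_mat n \<tau> M) = image_mset (image \<tau>) (edge_mset M)"
    and "mset_iso (edge_mset M) (edge_mset (quotient_mat n \<tau> M))"
proof -
  have im: "\<tau> ` {..<n} \<subseteq> {..<n}" using permutes_image[OF assms(2)] by simp
  show "quotient_mat n \<tau> M \<in> sym_mats n" by (rule edge_quotient_mat(1)[OF assms(1) im])
  show eq: "edge_mset (quotient_mat n \<tau> M) = image_mset (image \<tau>) (edge_mset M)"
    by (rule edge_mset_quotient_mat[OF assms(1) im])
  show "mset_iso (edge_mset M) (edge_mset (quotient_mat n \<tau> M))"
    by (rule mset_isoI[of \<tau>]) (use assms(2) in \<open>auto simp: eq permutes_inj_on\<close>)
qed

lemma quotient_permutation_upto:
  "M \<in> graphs_upto n d \<Longrightarrow> \<tau> permutes {..<n} \<Longrightarrow> quotient_mat n \<tau> M \<in> graphs_upto n d"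
  using quotient_permutation[of M n \<tau>] by (simp add: graphs_upto_def num_edges_eq)

lemma quotient_permutation_inverse:
  fixes M :: "nat mat"
  assumes "M \<in> sym_mats n" "\<tau> permutes {..<n}" "\<tau>' permutes {..<n}" "\<And>x. \<tau>' (\<tau> x) = x"
  shows "quotient_mat n \<tau>' (quotient_mat n \<tau> M) = M"
proof (rule edge_mset_inj)
  note q = quotient_permutation[OF assms(1,2)]
  show "quotient_mat n \<tau>' (quotient_mat n \<tau> M) \<in> sym_mats n"
    by (rule quotient_permutation(1)[OF q(1) assms(3)])
  show "edge_mset (quotient_mat n \<tau>' (quotient_mat n \<tau> M)) = edge_mset M"
    unfolding quotient_permutation(2)[OF q(1) assms(3)] q(2) image_mset_image_comp
    by (rule image_mset_image_id) (simp add: assms(4))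
qed (rule assms)

lemma mat_monomial_permute:
  assumes "M \<in> sym_mats n" "X \<in> sym_mats n" "\<tau> permutes {..<n}"
  shows "mat_monomial M (permute_mat \<tau> X) = mat_monomial (quotient_mat n \<tau> M) X"
proof -
  have "image_mset (edge (permute_mat \<tau> X)) (edge_mset M) = image_mset (\<lambda>e. edge X (\<tau> ` e)) (edge_mset M)"
    by (rule image_mset_cong, rule edge_permute_mat(2)[OF assms(2,3)])
      (use set_edge_mset[of M] in \<open>auto simp: sym_mats_dim[OF assms(1)]\<close>)
  then show ?thesis
    by (simp add: mat_monomial_eq quotient_permutation(2)[OF assms(1,3)] multiset.map_comp o_def)
qed

text \<open>A change of variables on exponents. The inverse \<open>\<tau>'\<close> is a variable of
  its own, so that both directions of the bijection are instances of the same facts.\<close>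

lemma sum_monomials_permute:
  assumes "X \<in> sym_mats n" "\<tau> permutes {..<n}" "\<tau>' permutes {..<n}"
    "\<And>x. \<tau>' (\<tau> x) = x" "\<And>x. \<tau> (\<tau>' x) = x"
  shows "(\<Sum>M\<in>graphs_upto n d. c M * mat_monomial M (permute_mat \<tau> X)) =
    (\<Sum>M\<in>graphs_upto n d. c (quotient_mat n \<tau>' M) * mat_monomial M X)"
proof (rule sum.reindex_bij_witness[where i = "quotient_mat n \<tau>'" and j = "quotient_mat n \<tau>"])
  fix M assume M: "M \<in> graphs_upto n d"
  then have Ms: "M \<in> sym_mats n" by (simp add: graphs_upto_def)
  show "quotient_mat n \<tau>' (quotient_mat n \<tau> M) = M"
    by (rule quotient_permutation_inverse[OF Ms assms(2,3,4)])
  then show "c (quotient_mat n \<tau>' (quotient_mat n \<tau> M)) * mat_monomial (quotient_mat n \<tau> M) X =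
      c M * mat_monomial M (permute_mat \<tau> X)"
    by (simp add: mat_monomial_permute[OF Ms assms(1,2)])
  show "quotient_mat n \<tau> M \<in> graphs_upto n d" by (rule quotient_permutation_upto[OF M assms(2)])
next
  fix M assume M: "M \<in> graphs_upto n d"
  then have Ms: "M \<in> sym_mats n" by (simp add: graphs_upto_def)
  show "quotient_mat n \<tau> (quotient_mat n \<tau>' M) = M"
    by (rule quotient_permutation_inverse[OF Ms assms(3,2,5)])
  show "quotient_mat n \<tau>' M \<in> graphs_upto n d" by (rule quotient_permutation_upto[OF M assms(3)])
qed

text \<open>The inverse appears so that the result matches \<open>sum_monomials_permute\<close>,
  where permuting the argument by \<open>\<tau>\<close> moves coefficients by the inverse.\<close>

lemma mset_iso_quotient_permutation:
  assumes "M \<in> sym_mats n" "M' \<in> sym_mats n" "mset_iso (edge_mset M) (edge_mset M')"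
  obtains \<tau> where "\<tau> permutes {..<n}" "M' = quotient_mat n (inv_into UNIV \<tau>) M"
proof -
  have "M' \<in> perm_orbit n M" using assms by (simp add: perm_orbit_eq)
  then obtain \<tau> where \<tau>: "\<tau> permutes {..<n}" "M' = permute_mat \<tau> M" by (auto simp: perm_orbit_def)
  let ?i = "inv_into UNIV \<tau>"
  have i: "?i permutes {..<n}" using \<tau>(1) by (rule permutes_inv)
  have "edge_mset (quotient_mat n ?i M) = image_mset (image ?i) (image_mset (image \<tau>) (edge_mset M'))"
    by (simp only: quotient_permutation(2)[OF assms(1) i] \<tau>(2) edge_mset_permute_mat[OF assms(1) \<tau>(1)])
  also have "\<dots> = edge_mset M'"
    unfolding image_mset_image_comp
    by (rule image_mset_image_id) (use \<tau>(1) in \<open>simp add: permutes_inverses\<close>)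
  finally have "M' = quotient_mat n ?i M"
    by (intro edge_mset_inj[OF assms(2) quotient_permutation(1)[OF assms(1) i]]) simp
  with \<tau>(1) that show thesis by blast
qed

lemma zero_pad_upto: "M \<in> graphs_upto n d \<Longrightarrow> n \<le> N \<Longrightarrow> zero_pad N M \<in> graphs_upto N d"
  using edge_zero_pad(1)[of M n N] edge_mset_zero_pad[of M n N]
  by (simp add: graphs_upto_def num_edges_eq)

lemma mat_monomial_zero_pad:
  assumes "M \<in> sym_mats n" "X \<in> sym_mats n" "n \<le> N"
  shows "mat_monomial (zero_pad N M) (zero_pad N X) = mat_monomial M X"
proof -
  have "image_mset (edge (zero_pad N X)) (edge_mset M) = image_mset (edge X) (edge_mset M)"
  proof (rule image_mset_cong)
    fix e assume "e \<in># edge_mset M"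
    then have "e \<in> edges_on n" using set_edge_mset[of M] by (auto simp: sym_mats_dim[OF assms(1)])
    then show "edge (zero_pad N X) e = edge X e"
      using edge_zero_pad(2)[OF assms(2,3), of e] edges_on_mono[OF assms(3)] by auto
  qed
  then show ?thesis by (simp add: mat_monomial_eq edge_mset_zero_pad[OF assms(1,3)])
qed

text \<open>A monomial with an edge leaving \<open>{..<n}\<close> picks up a padded zero and
  vanishes; the surviving exponents are exactly the zero-paddings of graphs of size
  \<open>n\<close>.\<close>

lemma sum_monomials_zero_pad:
  assumes "X \<in> sym_mats n" "n \<le> N"
  shows "(\<Sum>M\<in>graphs_upto N d. c M * mat_monomial M (zero_pad N X)) =
    (\<Sum>M\<in>graphs_upto n d. c (zero_pad N M) * mat_monomial M X)"
proof -
  have "(\<Sum>M\<in>graphs_upto N d. c M * mat_monomial M (zero_pad N X)) =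
      (\<Sum>M\<in>zero_pad N ` graphs_upto n d. c M * mat_monomial M (zero_pad N X))"
  proof (rule sum.mono_neutral_right)
    show "zero_pad N ` graphs_upto n d \<subseteq> graphs_upto N d" using zero_pad_upto[OF _ assms(2)] by blast
    show "\<forall>M\<in>graphs_upto N d - zero_pad N ` graphs_upto n d. c M * mat_monomial M (zero_pad N X) = 0"
    proof
      fix M assume M: "M \<in> graphs_upto N d - zero_pad N ` graphs_upto n d"
      then have Ms: "M \<in> sym_mats N" and "num_edges M \<le> d" by (auto simp: graphs_upto_def)
      have "\<not> set_mset (edge_mset M) \<subseteq> edges_on n"
      proof
        assume "set_mset (edge_mset M) \<subseteq> edges_on n"
        then have e: "edge_mset (graph_of n (edge_mset M)) = edge_mset M" by (rule edge_mset_graph_of)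
        have "graph_of n (edge_mset M) \<in> graphs_upto n d"
          using graph_of_sym \<open>num_edges M \<le> d\<close> by (simp add: graphs_upto_def num_edges_eq e)
        moreover have "M = zero_pad N (graph_of n (edge_mset M))"
          by (rule edge_mset_inj[OF Ms edge_zero_pad(1)[OF graph_of_sym assms(2)]])
            (simp add: edge_mset_zero_pad[OF graph_of_sym assms(2)] e)
        ultimately show False using M by blast
      qed
      then obtain e where e: "e \<in># edge_mset M" "e \<notin> edges_on n" by blast
      have "e \<in> edges_on N" using e(1) set_edge_mset[of M] by (auto simp: sym_mats_dim[OF Ms])
      then have "edge (zero_pad N X) e = 0" using edge_zero_pad(2)[OF assms] e(2) by simp
      then have "mat_monomial M (zero_pad N X) = 0"
        using imageI[OF e(1), of "edge (zero_pad N X)"] by (simp add: mat_monomial_eq prod_mset_zero_iff)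
      then show "c M * mat_monomial M (zero_pad N X) = 0" by simp
    qed
  qed simp
  also have "\<dots> = (\<Sum>M\<in>graphs_upto n d. c (zero_pad N M) * mat_monomial M X)"
  proof -
    have inj: "inj_on (zero_pad N) (graphs_upto n d)"
    proof (rule inj_onI)
      fix M M' assume M: "M \<in> graphs_upto n d" "M' \<in> graphs_upto n d" and eq: "zero_pad N M = zero_pad N M'"
      then have Ms: "M \<in> sym_mats n" "M' \<in> sym_mats n" by (auto simp: graphs_upto_def)
      have "edge_mset M = edge_mset M'"
        using edge_mset_zero_pad[OF Ms(1) assms(2)] edge_mset_zero_pad[OF Ms(2) assms(2)] eq by simp
      then show "M = M'" by (rule edge_mset_inj[OF Ms])
    qed
    show ?thesis
      unfolding sum.reindex[OF inj] o_def
      by (rule sum.cong) (auto simp: graphs_upto_def mat_monomial_zero_pad[OF _ assms])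
  qed
  finally show ?thesis .
qed

lemma iso_class_quotient_permutation:
  "M \<in> sym_mats n \<Longrightarrow> \<tau> permutes {..<n} \<Longrightarrow> iso_class (quotient_mat n \<tau> M) = iso_class M"
  using iso_class_eq_iff[OF is_graphI is_graphI[OF quotient_permutation(1)], of M n M n \<tau>]
    quotient_permutation(3)[of M n \<tau>] by simp

lemma iso_class_zero_pad:
  assumes "M \<in> sym_mats n" "n \<le> N"
  shows "iso_class (zero_pad N M) = iso_class M"
  using iso_class_eq_iff[OF is_graphI[OF edge_zero_pad(1)[OF assms]] is_graphI[OF assms(1)]]
  by (simp add: edge_mset_zero_pad[OF assms])

section \<open>Freely-described polynomials and their coefficients\<close>

lemma sum_seq_apply: "(\<Sum>i\<in>I. b i) n X = (\<Sum>i\<in>I. (b i :: mat_fun_seq) n X)"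
  by (induction I rule: infinite_finite_induct) simp_all

lemma restrict_seq_in:
  "1 \<le> n \<Longrightarrow> X \<in> sym_mats n \<Longrightarrow> restrict_seq p n X = p n X"
  by (simp add: restrict_seq_def)

lemma restrict_seq_eqI:
  assumes "restrict_seq q = q" "\<And>n X. 1 \<le> n \<Longrightarrow> X \<in> sym_mats n \<Longrightarrow> p n X = q n X"
  shows "restrict_seq p = q"
  by (subst assms(1)[symmetric]) (auto simp: restrict_seq_def fun_eq_iff assms(2))

lemma restrict_seq_restrict [simp]: "restrict_seq (restrict_seq p) = restrict_seq p"
  by (auto simp: restrict_seq_def fun_eq_iff)

lemma restrict_seq_sum:
  assumes "\<And>i. i \<in> I \<Longrightarrow> restrict_seq (b i) = b i"
  shows "restrict_seq (\<Sum>i\<in>I. scale_seq (a i) (b i)) = (\<Sum>i\<in>I. scale_seq (a i) (b i))"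
proof (intro ext)
  fix n and X :: "real mat"
  have "b i n X = 0" if "i \<in> I" "\<not> (1 \<le> n \<and> X \<in> sym_mats n)" for i
    using fun_cong[OF fun_cong[OF assms[OF that(1)]], of n X] that(2) by (auto simp: restrict_seq_def)
  then show "restrict_seq (\<Sum>i\<in>I. scale_seq (a i) (b i)) n X = (\<Sum>i\<in>I. scale_seq (a i) (b i)) n X"
    by (auto simp: restrict_seq_def sum_seq_apply scale_seq_def)
qed

lemma polynomial_deg_le_iff:
  "polynomial_deg_le n d q \<longleftrightarrow>
    (\<exists>c. \<forall>X\<in>sym_mats n. q X = (\<Sum>M\<in>graphs_upto n d. c M * mat_monomial M X))"
  by (simp add: polynomial_deg_le_def graphs_upto_def)

lemma subspace_freely_described: "seqs.subspace (freely_described d)"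
proof (rule seqs.subspaceI)
  show "0 \<in> freely_described d"
    by (auto simp: freely_described_def restrict_seq_def fun_eq_iff polynomial_deg_le_def
        intro!: exI[of _ "\<lambda>_. 0"])
next
  fix p q assume p: "p \<in> freely_described d" and q: "q \<in> freely_described d"
  have "polynomial_deg_le n d ((p + q) n)" if n: "n \<ge> 1" for n
  proof -
    have "polynomial_deg_le n d (p n)" "polynomial_deg_le n d (q n)"
      using p q n by (simp_all add: freely_described_def)
    then obtain a b where
      "\<forall>X\<in>sym_mats n. p n X = (\<Sum>M\<in>graphs_upto n d. a M * mat_monomial M X)"
      "\<forall>X\<in>sym_mats n. q n X = (\<Sum>M\<in>graphs_upto n d. b M * mat_monomial M X)"
      unfolding polynomial_deg_le_iff by (elim exE)
    then show ?thesis
      unfolding polynomial_deg_le_iff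
      by (intro exI[of _ "\<lambda>G. a G + b G"]) (simp add: distrib_right sum.distrib)
  qed
  moreover have "restrict_seq (p + q) = p + q"
  proof -
    have "restrict_seq (p + q) = restrict_seq p + restrict_seq q"
      by (auto simp: restrict_seq_def fun_eq_iff)
    then show ?thesis using p q by (simp add: freely_described_def)
  qed
  ultimately show "p + q \<in> freely_described d"
    using p q by (simp add: freely_described_def)
next
  fix r p assume p: "p \<in> freely_described d"
  have "polynomial_deg_le n d (scale_seq r p n)" if n: "n \<ge> 1" for n
  proof -
    have "polynomial_deg_le n d (p n)" using p n by (simp add: freely_described_def)
    then obtain a where
      "\<forall>X\<in>sym_mats n. p n X = (\<Sum>M\<in>graphs_upto n d. a M * mat_monomial M X)"
      unfolding polynomial_deg_le_iff by (elim exE)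
    then show ?thesis
      unfolding polynomial_deg_le_iff
      by (intro exI[of _ "\<lambda>G. r * a G"]) (simp add: scale_seq_def sum_distrib_left mult.assoc)
  qed
  moreover have "restrict_seq (scale_seq r p) = scale_seq r p"
  proof -
    have "restrict_seq (scale_seq r p) = scale_seq r (restrict_seq p)"
      by (auto simp: restrict_seq_def scale_seq_def fun_eq_iff)
    then show ?thesis using p by (simp add: freely_described_def)
  qed
  ultimately show "scale_seq r p \<in> freely_described d"
    using p by (simp add: freely_described_def scale_seq_def)
qed

text \<open>With the indicator of the class as coefficient, invariance and compatibility with
  padding reduce to the fact that \<open>iso_class\<close> does not change under relabelling and
  padding.\<close>

lemma sym_monomial_class:
  assumes "C \<in> iso_classes_upto d"
  shows "sym_monomial (rep C) n X =
    (\<Sum>M\<in>graphs_upto n d. of_bool (iso_class M = C) * mat_monomial M X)"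
  unfolding sym_monomial_rep[OF assms]
  by (rule sum.mono_neutral_cong_left) auto

lemma sym_monomial_freely_described:
  assumes "C \<in> iso_classes_upto d"
  shows "restrict_seq (sym_monomial (rep C)) \<in> freely_described d"
  unfolding freely_described_def
proof (intro CollectI conjI allI impI ballI)
  fix n :: nat assume n: "n \<ge> 1"
  show "polynomial_deg_le n d (restrict_seq (sym_monomial (rep C)) n)"
    unfolding polynomial_deg_le_iff
    by (rule exI[of _ "\<lambda>M. of_bool (iso_class M = C)"])
      (use n sym_monomial_class[OF assms] in \<open>simp add: restrict_seq_in\<close>)
  fix X :: "real mat" assume X: "X \<in> sym_mats n"
  show "restrict_seq (sym_monomial (rep C)) n (permute_mat \<sigma> X) = restrict_seq (sym_monomial (rep C)) n X"
    if s: "\<sigma> permutes {..<n}" for \<sigma>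
  proof -
    let ?i = "inv_into UNIV \<sigma>"
    have i: "?i permutes {..<n}" using s by (rule permutes_inv)
    have "sym_monomial (rep C) n (permute_mat \<sigma> X) =
        (\<Sum>M\<in>graphs_upto n d. of_bool (iso_class (quotient_mat n ?i M) = C) * mat_monomial M X)"
      unfolding sym_monomial_class[OF assms]
      by (rule sum_monomials_permute[OF X s i]) (use s in \<open>simp_all add: permutes_inverses\<close>)
    also have "\<dots> = sym_monomial (rep C) n X"
      unfolding sym_monomial_class[OF assms]
      by (rule sum.cong) (auto simp: graphs_upto_def iso_class_quotient_permutation[OF _ i])
    finally show ?thesis
      using n X edge_permute_mat(1)[OF X s] by (simp add: restrict_seq_in)
  qed
  fix N assume N: "N \<ge> n"
  have "sym_monomial (rep C) N (zero_pad N X) =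
      (\<Sum>M\<in>graphs_upto n d. of_bool (iso_class (zero_pad N M) = C) * mat_monomial M X)"
    unfolding sym_monomial_class[OF assms] by (rule sum_monomials_zero_pad[OF X N])
  also have "\<dots> = sym_monomial (rep C) n X"
    unfolding sym_monomial_class[OF assms]
    by (rule sum.cong) (auto simp: graphs_upto_def iso_class_zero_pad[OF _ N])
  finally show "restrict_seq (sym_monomial (rep C)) N (zero_pad N X) = restrict_seq (sym_monomial (rep C)) n X"
    using n N X edge_zero_pad(1)[OF X N] by (simp add: restrict_seq_in)
qed simp

text \<open>Provides every class with a witness among the exponents of one fixed size, where its
  coefficient can be read off.\<close>

lemma padded_rep:
  assumes "C \<in> iso_classes_upto d" "2 * d \<le> N"
  shows "zero_pad N (rep C) \<in> graphs_upto N d" "iso_class (zero_pad N (rep C)) = C"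
proof -
  note r = iso_classes_upto_rep[OF assms(1)]
  note g = iso_class_rep[OF r(1)]
  have v: "card (verts (rep C)) \<le> N" using r(3) assms(2) by simp
  show "zero_pad N (rep C) \<in> graphs_upto N d"
    by (rule zero_pad_upto[OF _ v]) (use g(3) r(2) in \<open>simp add: graphs_upto_def\<close>)
  show "iso_class (zero_pad N (rep C)) = C"
    using iso_class_zero_pad[OF g(3) v] g(2) by simp
qed

text \<open>The degree condition yields unrelated coefficient functions for the different
  \<open>n\<close>. A single function \<open>a\<close> on classes is obtained by reading
  coefficients at one reference size and transporting them from there.\<close>

lemma freely_described_coeffs:
  assumes p: "p \<in> freely_described d"
  obtains a where "\<And>n X. 1 \<le> n \<Longrightarrow> X \<in> sym_mats n \<Longrightarrow>
    p n X = (\<Sum>M\<in>graphs_upto n d. a (iso_class M) * mat_monomial M X)"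
proof -
  have deg: "\<And>n. 1 \<le> n \<Longrightarrow> polynomial_deg_le n d (p n)"
    and perm: "\<And>n \<sigma> X. 1 \<le> n \<Longrightarrow> \<sigma> permutes {..<n} \<Longrightarrow> X \<in> sym_mats n \<Longrightarrow> p n (permute_mat \<sigma> X) = p n X"
    and pad: "\<And>n N X. 1 \<le> n \<Longrightarrow> n \<le> N \<Longrightarrow> X \<in> sym_mats n \<Longrightarrow> p N (zero_pad N X) = p n X"
    using p by (auto simp: freely_described_def)
  have "\<forall>n. \<exists>c. 1 \<le> n \<longrightarrow> (\<forall>X\<in>sym_mats n. p n X = (\<Sum>M\<in>graphs_upto n d. c M * mat_monomial M X))"
    using deg unfolding polynomial_deg_le_iff by blast
  from choice[OF this] obtain c where c: "\<And>n X. 1 \<le> n \<Longrightarrow> X \<in> sym_mats n \<Longrightarrow>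
      p n X = (\<Sum>M\<in>graphs_upto n d. c n M * mat_monomial M X)" by blast
  have inv: "c n M' = c n M"
    if n: "1 \<le> n" and M: "M \<in> graphs_upto n d" "M' \<in> graphs_upto n d" and eq: "iso_class M = iso_class M'" for n M M'
  proof -
    have Ms: "M \<in> sym_mats n" "M' \<in> sym_mats n" using M by (auto simp: graphs_upto_def)
    have "mset_iso (edge_mset M) (edge_mset M')"
      using eq iso_class_eq_iff[OF is_graphI[OF Ms(1)] is_graphI[OF Ms(2)]] by simp
    then obtain \<tau> where \<tau>: "\<tau> permutes {..<n}" "M' = quotient_mat n (inv_into UNIV \<tau>) M"
      by (rule mset_iso_quotient_permutation[OF Ms])
    have i: "inv_into UNIV \<tau> permutes {..<n}" using \<tau>(1) by (rule permutes_inv)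
    have "c n (quotient_mat n (inv_into UNIV \<tau>) M) = c n M"
    proof (rule monomials_coeff_unique[OF _ M(1), of "\<lambda>M. c n (quotient_mat n (inv_into UNIV \<tau>) M)"])
      fix X :: "real mat" assume X: "X \<in> sym_mats n"
      have "(\<Sum>M\<in>graphs_upto n d. c n (quotient_mat n (inv_into UNIV \<tau>) M) * mat_monomial M X) =
          p n (permute_mat \<tau> X)"
        unfolding c[OF n edge_permute_mat(1)[OF X \<tau>(1)]]
        by (rule sum_monomials_permute[OF X \<tau>(1) i, symmetric])
          (use \<tau>(1) in \<open>simp_all add: permutes_inverses\<close>)
      also have "\<dots> = (\<Sum>M\<in>graphs_upto n d. c n M * mat_monomial M X)"
        using perm[OF n \<tau>(1) X] c[OF n X] by simp
      finally show "(\<Sum>M\<in>graphs_upto n d. c n (quotient_mat n (inv_into UNIV \<tau>) M) * mat_monomial M X) =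
          (\<Sum>M\<in>graphs_upto n d. c n M * mat_monomial M X)" .
    qed
    then show ?thesis using \<tau>(2) by simp
  qed
  \<comment> \<open>The reference size: at least \<open>2 * d\<close> so that every class fits, and
    at least 1 because sequences start there, which matters for \<open>d = 0\<close>.\<close>
  define m where "m = max 1 (2 * d)"
  have m: "1 \<le> m" "2 * d \<le> m" by (auto simp: m_def)
  define a where "a C = c m (zero_pad m (rep C))" for C
  have large: "p N X = (\<Sum>M\<in>graphs_upto N d. a (iso_class M) * mat_monomial M X)"
    if N: "m \<le> N" and X: "X \<in> sym_mats N" for N X
  proof -
    have N1: "1 \<le> N" using m(1) N by simp
    have "c N M = a (iso_class M)" if M: "M \<in> graphs_upto N d" for M
    proof -
      let ?R = "zero_pad m (rep (iso_class M))"
      note R = padded_rep[OF iso_class_upto[OF M] m(2)]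
      have Rs: "?R \<in> sym_mats m" using R(1) by (simp add: graphs_upto_def)
      have "c N (zero_pad N ?R) = c m ?R"
      proof (rule monomials_coeff_unique[OF _ R(1), of "\<lambda>M. c N (zero_pad N M)"])
        fix Y :: "real mat" assume Y: "Y \<in> sym_mats m"
        show "(\<Sum>M\<in>graphs_upto m d. c N (zero_pad N M) * mat_monomial M Y) =
            (\<Sum>M\<in>graphs_upto m d. c m M * mat_monomial M Y)"
          using pad[OF m(1) N Y] c[OF N1 edge_zero_pad(1)[OF Y N]] c[OF m(1) Y]
            sum_monomials_zero_pad[OF Y N, where c = "c N"] by simp
      qed
      moreover have "c N M = c N (zero_pad N ?R)"
        by (rule inv[OF N1 zero_pad_upto[OF R(1) N] M]) (simp add: iso_class_zero_pad[OF Rs N] R(2))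
      ultimately show ?thesis by (simp add: a_def)
    qed
    then show ?thesis unfolding c[OF N1 X] by (intro sum.cong) auto
  qed
  show thesis
  proof (rule that[of a])
    fix n :: nat and X :: "real mat" assume n: "1 \<le> n" and X: "X \<in> sym_mats n"
    \<comment> \<open>Below the reference size not every class is visible, so \<open>X\<close> is
      padded up to \<open>N\<close>, and the expansion found there is pulled back to size
      \<open>n\<close>.\<close>
    define N where "N = max n m"
    have N: "n \<le> N" "m \<le> N" by (auto simp: N_def)
    have "p n X = p N (zero_pad N X)" using pad[OF n N(1) X] by simp
    also have "\<dots> = (\<Sum>M\<in>graphs_upto n d. a (iso_class (zero_pad N M)) * mat_monomial M X)"
      unfolding large[OF N(2) edge_zero_pad(1)[OF X N(1)]] by (rule sum_monomials_zero_pad[OF X N(1)])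
    also have "\<dots> = (\<Sum>M\<in>graphs_upto n d. a (iso_class M) * mat_monomial M X)"
      by (rule sum.cong) (auto simp: graphs_upto_def iso_class_zero_pad[OF _ N(1)])
    finally show "p n X = (\<Sum>M\<in>graphs_upto n d. a (iso_class M) * mat_monomial M X)" .
  qed
qed

section \<open>Triangular changes of basis\<close>

text \<open>Injectivity of the indexing follows from the same hypothesis: two equal members would
  satisfy the relation with coefficients 1 and -1.\<close>

lemma independent_familyI:
  assumes "finite I"
    and zero: "\<And>a i. (\<Sum>i\<in>I. scale_seq (a i) (b i)) = 0 \<Longrightarrow> i \<in> I \<Longrightarrow> a i = 0"
  shows "inj_on b I" "seqs.independent (b ` I)"
proof -
  show inj: "inj_on b I"
  proof (rule inj_onI, rule ccontr)
    fix i j assume ij: "i \<in> I" "j \<in> I" "b i = b j" "i \<noteq> j"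
    define a where "a l = (if l = i then 1 else if l = j then - 1 else 0 :: real)" for l
    have "(\<Sum>l\<in>I. scale_seq (a l) (b l)) = (\<Sum>l\<in>{i, j}. scale_seq (a l) (b l))"
      by (rule sum.mono_neutral_right) (use assms(1) ij in \<open>auto simp: a_def\<close>)
    also have "\<dots> = 0" using ij by (simp add: a_def)
    finally have "a i = 0" using zero ij(1) by blast
    then show False by (simp add: a_def)
  qed
  show "seqs.independent (b ` I)"
  proof (rule seqs.independent_if_scalars_zero)
    fix f x assume "(\<Sum>x\<in>b ` I. scale_seq (f x) x) = 0" "x \<in> b ` I"
    then show "f x = 0" using zero[of "f \<circ> b"] by (auto simp: sum.reindex[OF inj])
  qed (use assms(1) in simp)
qed

text \<open>Independence is tested at a single size at which all classes occur; spanning is the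
  description of the coefficients.\<close>

lemma sym_monomial_basis:
  "is_basis (iso_classes_upto d) (\<lambda>C. restrict_seq (sym_monomial (rep C))) (freely_described d)"
proof -
  let ?I = "iso_classes_upto d" and ?b = "\<lambda>C. restrict_seq (sym_monomial (rep C))"
  have eval: "(\<Sum>C\<in>?I. scale_seq (a C) (?b C)) n X =
      (\<Sum>M\<in>graphs_upto n d. a (iso_class M) * mat_monomial M X)"
    if "1 \<le> n" "X \<in> sym_mats n" for a n X
    using that by (simp add: sum_seq_apply scale_seq_def restrict_seq_in sum_over_classes)
  have zero: "a C = 0" if 0: "(\<Sum>C\<in>?I. scale_seq (a C) (?b C)) = 0" and C: "C \<in> ?I" for a C
  proof -
    define m where "m = max 1 (2 * d)"
    have m: "1 \<le> m" "2 * d \<le> m" by (auto simp: m_def)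
    note R = padded_rep[OF C m(2)]
    have "a (iso_class (zero_pad m (rep C))) = 0"
      by (rule monomials_independent[OF finite_graphs_upto _ _ R(1), of m "\<lambda>M. a (iso_class M)"])
        (use eval[OF m(1), of _ a] in \<open>auto simp: 0 graphs_upto_def\<close>)
    then show ?thesis by (simp add: R(2))
  qed
  have "seqs.span (?b ` ?I) = freely_described d"
  proof
    show "seqs.span (?b ` ?I) \<subseteq> freely_described d"
      by (rule seqs.span_minimal[OF _ subspace_freely_described])
        (use sym_monomial_freely_described in blast)
    show "freely_described d \<subseteq> seqs.span (?b ` ?I)"
    proof
      fix p assume p: "p \<in> freely_described d"
      obtain a where a: "\<And>n X. 1 \<le> n \<Longrightarrow> X \<in> sym_mats n \<Longrightarrow>
          p n X = (\<Sum>M\<in>graphs_upto n d. a (iso_class M) * mat_monomial M X)"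
        using freely_described_coeffs[OF p] by metis
      have "restrict_seq p = (\<Sum>C\<in>?I. scale_seq (a C) (?b C))"
        by (rule restrict_seq_eqI[OF restrict_seq_sum]) (simp_all add: a eval)
      moreover have "restrict_seq p = p" using p by (simp add: freely_described_def)
      moreover have "(\<Sum>C\<in>?I. scale_seq (a C) (?b C)) \<in> seqs.span (?b ` ?I)"
        by (rule seqs.span_sum, rule seqs.span_scale, rule seqs.span_base) auto
      ultimately show "p \<in> seqs.span (?b ` ?I)" by simp
    qed
  qed
  moreover have "inj_on ?b ?I"
    by (rule independent_familyI(1)[OF finite_iso_classes_upto]) (rule zero)
  moreover have "seqs.independent (?b ` ?I)"
    by (rule independent_familyI(2)[OF finite_iso_classes_upto]) (rule zero)
  ultimately show ?thesis unfolding is_basis_def by blast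
qed

text \<open>Induction on the rank \<open>r\<close> solves for each \<open>b i\<close> in terms of
  the new family. Independence of \<open>b'\<close> then follows by counting, since a spanning
  family with no more members than a basis is a basis.\<close>

lemma basis_triangular:
  fixes r :: "'i \<Rightarrow> nat"
  assumes "finite I" "is_basis I b V"
    and expand: "\<And>i. i \<in> I \<Longrightarrow> b' i = (\<Sum>j\<in>I. scale_seq (a i j) (b j))"
    and diag: "\<And>i. i \<in> I \<Longrightarrow> a i i \<noteq> 0"
    and tri: "\<And>i j. i \<in> I \<Longrightarrow> j \<in> I \<Longrightarrow> a i j \<noteq> 0 \<Longrightarrow> j = i \<or> r j < r i"
  shows "is_basis I b' V"
proof -
  have b: "inj_on b I" "seqs.independent (b ` I)" "seqs.span (b ` I) = V"
    using assms(2) by (auto simp: is_basis_def)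
  have b_span: "b i \<in> seqs.span (b' ` I)" if "i \<in> I" for i
    using that
  proof (induction "r i" arbitrary: i rule: less_induct)
    case less
    have "(\<Sum>j\<in>I - {i}. scale_seq (a i j) (b j)) \<in> seqs.span (b' ` I)"
    proof (rule seqs.span_sum)
      fix j assume j: "j \<in> I - {i}"
      show "scale_seq (a i j) (b j) \<in> seqs.span (b' ` I)"
      proof (cases "a i j = 0")
        case True
        then show ?thesis by (simp add: seqs.span_zero)
      next
        case False
        then have "r j < r i" using tri[OF less.prems, of j] j by auto
        then show ?thesis using j by (intro seqs.span_scale less.hyps) auto
      qed
    qed
    then have "scale_seq (1 / a i i) (b' i - (\<Sum>j\<in>I - {i}. scale_seq (a i j) (b j))) \<in> seqs.span (b' ` I)"
      by (intro seqs.span_scale seqs.span_diff) (use less.prems in \<open>auto intro: seqs.span_base\<close>)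
    also have "b' i - (\<Sum>j\<in>I - {i}. scale_seq (a i j) (b j)) = scale_seq (a i i) (b i)"
      unfolding expand[OF less.prems] by (subst sum.remove[OF assms(1) less.prems]) simp
    also have "scale_seq (1 / a i i) (scale_seq (a i i) (b i)) = b i"
      using diag[OF less.prems] by simp
    finally show ?case .
  qed
  have sub: "b' ` I \<subseteq> seqs.span (b ` I)"
  proof (rule image_subsetI)
    fix i assume "i \<in> I"
    show "b' i \<in> seqs.span (b ` I)"
      unfolding expand[OF \<open>i \<in> I\<close>]
      by (rule seqs.span_sum, rule seqs.span_scale, rule seqs.span_base) auto
  qed
  have span: "seqs.span (b' ` I) = V"
    unfolding b(3)[symmetric]
    by (rule equalityI; rule seqs.span_minimal[OF _ seqs.subspace_span])
      (rule sub, rule image_subsetI, rule b_span)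
  \<comment> \<open>The exchange lemma: no finite set spanning the old basis has fewer than
    \<open>card I\<close> elements.\<close>
  have bound: "card I \<le> card T" if "finite T" "b ` I \<subseteq> seqs.span T" for T
    using seqs.independent_span_bound[OF that(1) b(2) that(2)] by (simp only: card_image[OF b(1)])
  have b_sub: "b ` I \<subseteq> seqs.span (b' ` I)" using b_span by (rule image_subsetI)
  then have "card I \<le> card (b' ` I)" using assms(1) by (intro bound) simp_all
  then have card: "card (b' ` I) = card I" using card_image_le[OF assms(1), of b'] by simp
  then have "inj_on b' I" by (rule eq_card_imp_inj_on[OF assms(1)])
  \<comment> \<open>A dependent vector could be dropped without shrinking the span, leaving fewer
    vectors than the exchange bound allows.\<close>
  moreover have "seqs.independent (b' ` I)"
  proof
    assume "seqs.dependent (b' ` I)"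
    then obtain x where x: "x \<in> b' ` I" "x \<in> seqs.span (b' ` I - {x})"
      unfolding seqs.dependent_def by blast
    have "b' ` I \<subseteq> seqs.span (b' ` I - {x})"
    proof
      fix y assume "y \<in> b' ` I"
      then show "y \<in> seqs.span (b' ` I - {x})"
        using x(2) by (cases "y = x") (simp_all add: seqs.span_base)
    qed
    then have "seqs.span (b' ` I) \<subseteq> seqs.span (b' ` I - {x})"
      by (rule seqs.span_minimal) (rule seqs.subspace_span)
    then have "b ` I \<subseteq> seqs.span (b' ` I - {x})" using b_sub by (rule order_trans[rotated])
    with assms(1) have "card I \<le> card (b' ` I - {x})" by (intro bound) simp_all
    then show False using card_Diff1_less[OF finite_imageI[OF assms(1)] x(1)] card by simp
  qed
  ultimately show ?thesis using span by (simp add: is_basis_def)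
qed

lemma num_maps_nonzero:
  assumes "num_maps A B \<noteq> 0" "finite (supp A)"
  shows "card (supp B) \<le> card (supp A)" "card (supp B) = card (supp A) \<Longrightarrow> mset_iso A B"
proof -
  obtain f where f: "image_mset (image f) A = B"
  proof -
    have "{f \<in> extensional (supp A). image_mset (image f) A = B} \<noteq> {}"
      using assms(1) unfolding num_maps_def by (intro notI) (simp only: card.empty)
    then show thesis using that by blast
  qed
  have s: "supp B = f ` supp A" using supp_image[of f A] f by simp
  show "card (supp B) \<le> card (supp A)" unfolding s by (rule card_image_le[OF assms(2)])
  assume "card (supp B) = card (supp A)"
  then have "inj_on f (supp A)" unfolding s by (rule eq_card_imp_inj_on[OF assms(2)])
  then show "mset_iso A B" using f by (rule mset_isoI)
qed

text \<open>Serves both directions of triangularity: the homomorphism family fixes \<open>C\<close>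
  and varies \<open>D\<close>, the expectation family fixes \<open>D\<close> and varies
  \<open>C\<close>.\<close>

lemma num_refinements_nonzero:
  assumes "C \<in> iso_classes" "D \<in> iso_classes" "num_refinements (rep C) (rep D) \<noteq> 0"
  shows "D = C \<or> card (verts (rep D)) < card (verts (rep C))"
proof -
  note C = iso_class_rep[OF assms(1)] and D = iso_class_rep[OF assms(2)]
  have "num_maps (edge_mset (rep C)) (edge_mset (rep D)) \<noteq> 0"
    using assms(3) num_refinements_eq[OF C(1) D(1)] by simp
  note n = num_maps_nonzero[OF this finite_supp_edge_mset]
  show ?thesis
  proof (cases "card (supp (edge_mset (rep D))) = card (supp (edge_mset (rep C)))")
    case True
    then have "mset_iso (edge_mset (rep C)) (edge_mset (rep D))" by (rule n(2))
    then show ?thesis using iso_class_eq_iff[OF C(1) D(1)] C(2) D(2) by simp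
  next
    case False
    then show ?thesis using n(1) verts_graph[OF C(1)] verts_graph[OF D(1)] by simp
  qed
qed

text \<open>Common frame for the three remaining families, which differ in the coefficients and in
  the rank only.\<close>

lemma sym_monomial_triangular:
  fixes r :: "nat mat set \<Rightarrow> nat"
  assumes expand: "\<And>C n X. C \<in> iso_classes_upto d \<Longrightarrow> 1 \<le> n \<Longrightarrow> X \<in> sym_mats n \<Longrightarrow>
      q C n X = (\<Sum>D\<in>iso_classes_upto d. a C D * sym_monomial (rep D) n X)"
    and diag: "\<And>C. C \<in> iso_classes_upto d \<Longrightarrow> a C C \<noteq> 0"
    and tri: "\<And>C D. C \<in> iso_classes_upto d \<Longrightarrow> D \<in> iso_classes_upto d \<Longrightarrow> a C D \<noteq> 0 \<Longrightarrow> D = C \<or> r D < r C"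
  shows "is_basis (iso_classes_upto d) (\<lambda>C. restrict_seq (q C)) (freely_described d)"
proof (rule basis_triangular[OF finite_iso_classes_upto sym_monomial_basis _ diag tri])
  fix C assume C: "C \<in> iso_classes_upto d"
  show "restrict_seq (q C) =
      (\<Sum>D\<in>iso_classes_upto d. scale_seq (a C D) (restrict_seq (sym_monomial (rep D))))"
    by (rule restrict_seq_eqI[OF restrict_seq_sum])
      (simp_all add: expand[OF C] sum_seq_apply scale_seq_def restrict_seq_in)
qed

text \<open>Proper quotients lose vertices, so the vertex count serves as rank; the diagonal
  coefficients count automorphisms.\<close>

lemma hom_poly_basis:
  "is_basis (iso_classes_upto d) (\<lambda>C. restrict_seq (\<lambda>n. hom_poly (rep C))) (freely_described d)"
proof (rule sym_monomial_triangular[where r = "\<lambda>C. card (verts (rep C))"])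
  fix C assume "C \<in> iso_classes_upto d"
  note C = iso_classes_upto_rep[OF this]
  note g = iso_class_rep(1)[OF C(1)]
  show "hom_poly (rep C) X = (\<Sum>D\<in>iso_classes_upto d. real (num_refinements (rep C) (rep D)) * sym_monomial (rep D) n X)"
    if "X \<in> sym_mats n" for n X
    by (rule hom_poly_eq[OF g C(2) that])
  show "real (num_refinements (rep C) (rep C)) \<noteq> 0" using num_refinements_self[OF g] by simp
  fix D assume "D \<in> iso_classes_upto d" "real (num_refinements (rep C) (rep D)) \<noteq> 0"
  then show "D = C \<or> card (verts (rep D)) < card (verts (rep C))"
    using num_refinements_nonzero[OF C(1) iso_classes_upto_rep(1)[of D d]] by simp
qed

text \<open>The change of basis is diagonal, with the numbers of automorphisms as entries, so a
  constant rank suffices.\<close>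

lemma inj_poly_basis:
  "is_basis (iso_classes_upto d) (\<lambda>C. restrict_seq (\<lambda>n. inj_poly (rep C))) (freely_described d)"
proof (rule sym_monomial_triangular[where r = "\<lambda>_. 0"
      and a = "\<lambda>C D. if D = C then real (num_refinements (rep C) (rep C)) else 0"])
  fix C assume C: "C \<in> iso_classes_upto d"
  note g = iso_class_rep(1)[OF iso_classes_upto_rep(1)[OF C]]
  show "inj_poly (rep C) X = (\<Sum>D\<in>iso_classes_upto d.
      (if D = C then real (num_refinements (rep C) (rep C)) else 0) * sym_monomial (rep D) n X)"
    if "X \<in> sym_mats n" for n X
    using C by (simp add: inj_poly_eq[OF g that] if_distrib[of "\<lambda>x. x * _"] cong: if_cong)
  show "(if C = C then real (num_refinements (rep C) (rep C)) else 0) \<noteq> 0"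
    using num_refinements_self[OF g] by simp
qed (simp split: if_splits)

text \<open>Proper refinements gain vertices, so the rank counts the vertices missing from the
  maximum \<open>2 * d\<close>. The bound on \<open>k\<close> makes the expansion available for
  every class.\<close>

lemma expected_poly_basis:
  assumes "1 \<le> k" "2 * d \<le> k"
  shows "is_basis (iso_classes_upto d) (\<lambda>C. restrict_seq (expected_poly k (rep C))) (freely_described d)"
proof (rule sym_monomial_triangular[where r = "\<lambda>C. 2 * d - card (verts (rep C))"])
  fix C assume "C \<in> iso_classes_upto d"
  note C = iso_classes_upto_rep[OF this]
  note g = iso_class_rep(1)[OF C(1)]
  let ?a = "\<lambda>D. real (graph_fact (rep C)) / real (graph_fact (rep D))
      * ((fact k / fact (k - card (verts (rep C)))) / real k ^ card (verts (rep D)))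
      * (real (num_refinements (rep D) (rep C)) / real (num_refinements (rep C) (rep C)))"
  have v: "card (verts (rep C)) \<le> k" using C(3) assms(2) by simp
  show "expected_poly k (rep C) n X = (\<Sum>D\<in>iso_classes_upto d. ?a D * sym_monomial (rep D) n X)"
    if "X \<in> sym_mats n" for n X
    by (rule expected_poly_eq[OF g C(2) that assms(1) v])
  show "?a C \<noteq> 0"
    using num_refinements_self[OF g] assms(1) by (simp add: graph_fact_eq)
  fix D assume "D \<in> iso_classes_upto d" "?a D \<noteq> 0"
  then have D: "D \<in> iso_classes" "card (verts (rep D)) \<le> 2 * d" "num_refinements (rep D) (rep C) \<noteq> 0"
    using iso_classes_upto_rep[of D d] by auto
  \<comment> \<open>Truncated subtraction keeps the inequality strict because \<open>D\<close> has
    at most \<open>2 * d\<close> vertices.\<close>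
  then show "D = C \<or> 2 * d - card (verts (rep D)) < 2 * d - card (verts (rep C))"
    using num_refinements_nonzero[OF D(1) C(1)] by auto
qed

theorem proposition6p9:
  shows
    "(\<forall>H k n X. is_graph H \<longrightarrow> 1 \<le> k \<longrightarrow> card (verts H) \<le> k \<longrightarrow> 1 \<le> n \<longrightarrow> X \<in> sym_mats n \<longrightarrow>
        expected_poly k H n X =
          (\<Sum>C \<in> {C \<in> iso_classes. is_refinement (rep C) H}. let G = rep C in
             real (graph_fact H) / real (graph_fact G)
             * ((fact k / fact (k - card (verts H))) / real k ^ card (verts G))
             * (real (num_refinements G H) / real (num_refinements H H))
             * sym_monomial G n X))
     \<and> (\<forall>d k. 1 \<le> k \<longrightarrow> 2 * d \<le> k \<longrightarrow>
          is_basis (iso_classes_upto d) (\<lambda>C. restrict_seq (expected_poly k (rep C)))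
            (freely_described d))
     \<and> (\<forall>d. is_basis (iso_classes_upto d) (\<lambda>C. restrict_seq (sym_monomial (rep C)))
            (freely_described d))
     \<and> (\<forall>d. is_basis (iso_classes_upto d) (\<lambda>C. restrict_seq (\<lambda>n. inj_poly (rep C)))
            (freely_described d))
     \<and> (\<forall>d. is_basis (iso_classes_upto d) (\<lambda>C. restrict_seq (\<lambda>n. hom_poly (rep C)))
            (freely_described d))"
  using expected_poly_refinements expected_poly_basis sym_monomial_basis inj_poly_basis hom_poly_basis
  unfolding Let_def by (intro conjI allI impI) simp_all

end
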